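(* There is an absolute constant $c>0$ with the following property. Let $m>2$ be an integer, let $K=\mathbb{Q}(\zeta_m)$ be the $m$-th cyclotomic field ($\zeta_m$ a primitive $m$-th root of unity), let $d=\varphi(m)$, and let $\beta_1,\ldots,\beta_n$ be non-zero elements of $K$. Then there exists a prime number $p$ satisfying $$ p\le \Big(d\sum_{i=1}^{n}\mathrm{h}(\beta_i)+dn\Big)^{c\, d\,\delta(m)} $$ and a field embedding $\sigma: K\hookrightarrow \mathbb{Q}_p$ such that $|\sigma(\beta_i)|_p=1$ for $1\le i\le n$.
   Context: $\varphi$ is Euler's totient function. For an integer $m\ge2$, let $\ell=P(m)$ be the largest prime divisor of $m$ and let $e$ be the largest integer with $\ell^e\mid m$; define $\delta(m)=\varphi(m/\ell^e)$ if $\ell\equiv 1\pmod{m/\ell^e}$, and $\delta(m)=1$ otherwise. $\mathbb{Q}_p$ is the field of $p$-adic numbers and $|\cdot|_p$ its $p$-adic absolute value. For an algebraic number $\gamma$ of degree $k$ with minimal polynomial $f(x)=a_k(x-\gamma_1)\cdots(x-\gamma_k)\in\mathbb{Z}[x]$ (irreducible, coprime coefficients), its Mahler measure is $M(\gamma)=|a_k|\prod_{j=1}^k\max\{1,|\gamma_j|\}$, and its absolute logarithmic (Weil) height is $\mathrm{h}(\gamma)=k^{-1}\log M(\gamma)$. *)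

theory Defs
  imports
    "HOL-Number_Theory.Number_Theory"
    "HOL-Algebra.Algebraic_Closure_Type"
    "HOL-Algebra.Generated_Fields"
    "HOL-Algebra.QuotRing"
    "Berlekamp_Zassenhaus.Mahler_Measure"
begin

definition delta :: "nat \<Rightarrow> nat" where
  "delta m =
     (let l = Max (prime_factors m); k = m div l ^ multiplicity l m
      in if [l = 1] (mod k) then totient k else 1)"

text \<open>The minimal polynomial in \<open>\<int>[x]\<close> is only determined up to sign; the sign is fixed
  by requiring a positive leading coefficient.\<close>

definition min_int_poly :: "complex \<Rightarrow> int poly" where
  "min_int_poly \<gamma> = (THE f. Factorial_Ring.irreducible f \<and> content f = 1 \<and>
     Polynomial.lead_coeff f > 0 \<and> poly (map_poly of_int f) \<gamma> = 0)"

definition weil_height :: "complex \<Rightarrow> real" where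
  "weil_height \<gamma> =
     ln (mahler_measure (min_int_poly \<gamma>)) / real (Polynomial.degree (min_int_poly \<gamma>))"

definition primitive_root_of_unity :: "nat \<Rightarrow> complex \<Rightarrow> bool" where
  "primitive_root_of_unity m \<zeta> \<longleftrightarrow> \<zeta> ^ m = 1 \<and> (\<forall>k. 0 < k \<and> k < m \<longrightarrow> \<zeta> ^ k \<noteq> 1)"

text \<open>The subfield \<open>\<rat>(\<zeta>)\<close> of \<open>\<complex>\<close>.\<close>

definition rat_adjoin :: "complex \<Rightarrow> complex ring" where
  "rat_adjoin \<zeta> =
     ring_of_type_algebra\<lparr>carrier := generate_field ring_of_type_algebra {\<zeta>}\<rparr>"

text \<open>The field \<open>\<rat>\<^sub>p\<close> is the completion of \<open>\<rat>\<close> for the \<open>p\<close>-adic absolute value: Cauchy sequences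
  of rationals modulo null sequences. These definitions are meaningful for prime \<open>p\<close> only.\<close>

definition padic_abs_rat :: "nat \<Rightarrow> rat \<Rightarrow> real" where
  "padic_abs_rat p q =
     (if q = 0 then 0
      else case quotient_of q of (a, b) \<Rightarrow>
        real p powi (int (multiplicity (int p) b) - int (multiplicity (int p) a)))"

definition padic_Cauchy :: "nat \<Rightarrow> (nat \<Rightarrow> rat) \<Rightarrow> bool" where
  "padic_Cauchy p x \<longleftrightarrow>
     (\<forall>e>0. \<exists>N. \<forall>i\<ge>N. \<forall>j\<ge>N. padic_abs_rat p (x i - x j) < e)"

definition padic_Cauchy_ring :: "nat \<Rightarrow> (nat \<Rightarrow> rat) ring" where
  "padic_Cauchy_ring p =
     \<lparr>carrier = {x. padic_Cauchy p x},
      monoid.mult = (\<lambda>x y i. x i * y i), one = (\<lambda>i. 1),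
      ring.zero = (\<lambda>i. 0), add = (\<lambda>x y i. x i + y i)\<rparr>"

definition padic_null :: "nat \<Rightarrow> (nat \<Rightarrow> rat) set" where
  "padic_null p = {x. (\<lambda>i. padic_abs_rat p (x i)) \<longlonglongrightarrow> 0}"

definition padic_field :: "nat \<Rightarrow> (nat \<Rightarrow> rat) set ring" where
  "padic_field p = padic_Cauchy_ring p Quot padic_null p"

text \<open>The absolute value of a residue class is the common limit over its representatives.\<close>

definition padic_abs :: "nat \<Rightarrow> (nat \<Rightarrow> rat) set \<Rightarrow> real" where
  "padic_abs p A = (THE r. \<forall>x\<in>A. (\<lambda>i. padic_abs_rat p (x i)) \<longlonglongrightarrow> r)"

end

theory Submission
  imports Defs "Berlekamp_Zassenhaus.Factor_Bound"
begin

text \<open>Let \<open>f\<close> be the minimal polynomial of \<open>\<zeta>\<close>, of degree \<open>D \<le> \<phi>(m)\<close>. A prime \<open>p\<close> that divides some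
  value \<open>f(r)\<close> but not \<open>m\<close> gives an embedding of \<open>\<rat>(\<zeta>)\<close> into \<open>\<rat>\<^sub>p\<close>, sending \<open>\<zeta>\<close> to the Teichmueller
  representative of \<open>r\<close>. Every embedding maps \<open>\<beta>\<^sub>i\<close> to a \<open>p\<close>-adic unit as soon as \<open>p\<close> divides neither the
  leading nor the constant coefficient of the minimal polynomial of \<open>\<beta>\<^sub>i\<close>; both are bounded by the
  Mahler measure, so the number \<open>k\<close> of bad primes is linear in \<open>\<phi>(m) \<Sum>\<^sub>i h(\<beta>\<^sub>i)\<close>.

  If only bad primes divided \<open>P = \<Prod>\<^sub>a\<^sub>\<le>\<^sub>A |f(ma)|\<close>, then, since \<open>f\<close> has at most \<open>D\<close> zeros modulo each
  prime power involved, \<open>P\<close> would be at most \<open>A!^D (mA + 1)^(k D^2)\<close>, whereas \<open>P \<ge> (2^A A!)^D\<close>. These bounds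
  are incompatible already for \<open>A\<close> polynomial in \<open>\<phi>(m) \<Sum>\<^sub>i h(\<beta>\<^sub>i) + \<phi>(m) n\<close>, and then \<open>p \<le> (mA + 1)^D\<close> has the required
  size, because \<open>\<delta>(m) \<ge> 1\<close>.\<close>

section \<open>Minimal integer polynomials\<close>

text \<open>A nonzero annihilating polynomial of least degree, made primitive with positive leading
  coefficient, works: the pseudo-remainder of any annihilating \<open>h\<close> has smaller degree,
  so it is zero, and Gauss's lemma removes the multiplier \<open>a\<close> introduced by
  pseudo-division.\<close>

lemma exists_generating_int_poly:
  fixes \<gamma> :: complex
  assumes "g \<noteq> 0" "poly (of_int_poly g) \<gamma> = 0"
  shows "\<exists>f. content f = 1 \<and> Polynomial.lead_coeff f > 0 \<and>
    (\<forall>h. poly (of_int_poly h) \<gamma> = 0 \<longleftrightarrow> f dvd h)"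
proof -
  let ?Q = "\<lambda>h::int poly. h \<noteq> 0 \<and> poly (of_int_poly h) \<gamma> = 0"
  define g0 where "g0 = arg_min Polynomial.degree ?Q"
  have g0: "g0 \<noteq> 0" "poly (of_int_poly g0) \<gamma> = 0"
    and g0_min: "\<And>h. ?Q h \<Longrightarrow> Polynomial.degree g0 \<le> Polynomial.degree h"
    using arg_min_natI[of ?Q g Polynomial.degree] arg_min_nat_le[of ?Q _ Polynomial.degree] assms
    unfolding g0_def by auto
  define f where "f = Polynomial.smult (sgn (Polynomial.lead_coeff g0)) (primitive_part g0)"
  have lc0: "Polynomial.lead_coeff g0 \<noteq> 0" using g0 by simp
  have s2: "sgn (Polynomial.lead_coeff g0) * sgn (Polynomial.lead_coeff g0) = 1"
    using lc0 by (simp add: sgn_if)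
  have pp: "primitive_part g0 = Polynomial.smult (sgn (Polynomial.lead_coeff g0)) f"
    unfolding f_def using s2 by simp
  have g0_f: "g0 = Polynomial.smult (content g0 * sgn (Polynomial.lead_coeff g0)) f"
    using content_times_primitive_part[of g0] unfolding pp by simp
  have cont: "content f = 1"
    unfolding f_def using g0 lc0 by (simp add: sgn_if)
  have deg: "Polynomial.degree f = Polynomial.degree g0"
    unfolding f_def using lc0 by (simp add: sgn_if)
  have "Polynomial.lead_coeff g0 = content g0 * sgn (Polynomial.lead_coeff g0) * Polynomial.lead_coeff f"
    using arg_cong[OF g0_f, of Polynomial.lead_coeff] g0(1) lc0 by (simp add: sgn_eq_0_iff)
  moreover have "content g0 > 0"
    using g0(1) content_eq_zero_iff[of g0] normalize_content[of g0] 
    by (metis abs_ge_zero normalize_int_def order_le_less)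
  ultimately have lc: "Polynomial.lead_coeff f > 0"
    using lc0 by (auto simp: sgn_if zero_less_mult_iff mult_less_0_iff split: if_splits)
  have fr: "poly (of_int_poly f) \<gamma> = 0"
  proof -
    have "of_int (content g0 * sgn (Polynomial.lead_coeff g0)) * poly (of_int_poly f) \<gamma> = 0"
      using g0(2) arg_cong[OF g0_f, of "\<lambda>h. poly (of_int_poly h) \<gamma>"]
      by (simp add: of_int_hom.map_poly_hom_smult)
    moreover have "content g0 * sgn (Polynomial.lead_coeff g0) \<noteq> 0"
      using g0 by (simp add: sgn_if)
    ultimately show ?thesis by (metis mult_eq_0_iff of_int_eq_0_iff)
  qed
  have f0: "f \<noteq> 0" using lc by auto
  have "f dvd h" if h: "poly (of_int_poly h) \<gamma> = 0" for h
  proof -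
    obtain a q where a: "a \<noteq> 0" "Polynomial.smult a h = f * q + pseudo_mod h f"
      using pseudo_mod(1)[OF f0] by blast
    have "poly (of_int_poly (Polynomial.smult a h)) \<gamma> = poly (of_int_poly (f * q + pseudo_mod h f)) \<gamma>"
      using a(2) by simp
    hence "poly (of_int_poly (pseudo_mod h f)) \<gamma> = 0"
      using h fr by (simp add: of_int_hom.map_poly_hom_smult of_int_poly_hom.hom_add of_int_poly_hom.hom_mult)
    hence "pseudo_mod h f = 0"
      using g0_min[of "pseudo_mod h f"] pseudo_mod(2)[OF f0, of h] deg by fastforce
    hence "f dvd Polynomial.smult a h" using a(2) by simp
    from dvd_smult_int[OF a(1) this] show ?thesis using cont by (simp add: primitive_part_prim)
  qed
  moreover have "poly (of_int_poly h) \<gamma> = 0" if "f dvd h" for h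
    using that fr by (auto simp: of_int_poly_hom.hom_mult)
  ultimately show ?thesis using cont lc by blast
qed

text \<open>The integer polynomials vanishing at \<open>\<gamma>\<close> form a prime ideal, as
  \<open>\<complex>\<close> has no zero divisors, and its generator inherits irreducibility.\<close>

lemma irreducible_generating_int_poly:
  fixes \<gamma> :: complex
  assumes cont: "content f = 1"
    and gen: "\<And>h. poly (of_int_poly h) \<gamma> = 0 \<longleftrightarrow> f dvd h"
  shows "Factorial_Ring.irreducible f"
proof (rule Factorial_Ring.irreducibleI)
  show f0: "f \<noteq> 0" using cont by auto
  show "\<not> is_unit f"
  proof
    assume "is_unit f"
    hence "f dvd 1" by simp
    thus False using gen[of 1] by simp
  qed
next
  fix a b assume ab: "f = a * b"
  have f0: "f \<noteq> 0" using cont by auto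
  have "poly (of_int_poly f) \<gamma> = 0" using gen by simp
  hence "poly (of_int_poly a) \<gamma> = 0 \<or> poly (of_int_poly b) \<gamma> = 0"
    unfolding ab by (simp add: of_int_poly_hom.hom_mult)
  hence "f dvd a \<or> f dvd b" using gen by blast
  moreover have "a \<noteq> 0" "b \<noteq> 0" using ab f0 by auto
  ultimately show "is_unit a \<or> is_unit b"
    unfolding ab by (auto simp: dvd_mult_imp_div)
qed

text \<open>The definite description in \<open>min_int_poly\<close> is meaningful: a second
  candidate \<open>h\<close> is a multiple of the generator \<open>f\<close>, by irreducibility the
  cofactor is a unit, and the signs of the leading coefficients make it \<open>1\<close>. The
  witness \<open>g\<close> expresses that \<open>\<gamma>\<close> is algebraic.\<close>

lemma
  fixes \<gamma> :: complex
  assumes "g \<noteq> 0" "poly (of_int_poly g) \<gamma> = 0"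
  shows irreducible_min_int_poly: "Factorial_Ring.irreducible (min_int_poly \<gamma>)"
    and lead_coeff_min_int_poly: "Polynomial.lead_coeff (min_int_poly \<gamma>) > 0"
    and min_int_poly_dvd_iff:
      "\<And>h. min_int_poly \<gamma> dvd h \<longleftrightarrow> poly (of_int_poly h) \<gamma> = 0"
proof -
  obtain f where f: "content f = 1" "Polynomial.lead_coeff f > 0"
    "\<And>h. poly (of_int_poly h) \<gamma> = 0 \<longleftrightarrow> f dvd h"
    using exists_generating_int_poly[OF assms] by blast
  note irr = irreducible_generating_int_poly[OF f(1,3)]
  have uniq: "h = f" if h: "Factorial_Ring.irreducible h" "Polynomial.lead_coeff h > 0"
      "poly (of_int_poly h) \<gamma> = 0" for h
  proof -
    have "f dvd h" using f h by blast
    then obtain q where q: "h = f * q" by auto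
    hence "is_unit q" using Factorial_Ring.irreducibleD[OF h(1) q] irreducible_not_unit[OF irr] by blast
    then obtain c where c: "q = [:c:]" "is_unit c" by (auto simp: is_unit_poly_iff)
    hence "Polynomial.lead_coeff h = Polynomial.lead_coeff f * c" using q by (simp add: lead_coeff_mult)
    with c(2) f(2) h(2) have "c = 1" by (auto simp: zero_less_mult_iff)
    thus ?thesis using q c by simp
  qed
  have "min_int_poly \<gamma> = f" unfolding min_int_poly_def
  proof (rule the_equality)
    have "poly (of_int_poly f) \<gamma> = 0" using f(3)[of f] by simp
    thus "Factorial_Ring.irreducible f \<and> content f = 1 \<and> Polynomial.lead_coeff f > 0 \<and>
      poly (of_int_poly f) \<gamma> = 0" using f(1,2) irr by blast
  qed (use uniq in blast)
  thus "Factorial_Ring.irreducible (min_int_poly \<gamma>)"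
    "Polynomial.lead_coeff (min_int_poly \<gamma>) > 0"
    "\<And>h. min_int_poly \<gamma> dvd h \<longleftrightarrow> poly (of_int_poly h) \<gamma> = 0"
    by (simp_all only: f irr)
qed

section \<open>The field of rational expressions in an algebraic number\<close>

text \<open>Field elements are handled through representing rational polynomials, because the same
  polynomial can later be evaluated at \<open>p\<close>-adic approximations of
  \<open>\<zeta>\<close>.\<close>

definition rat_eval :: "complex \<Rightarrow> rat poly \<Rightarrow> complex" where
  "rat_eval z h = poly (map_poly of_rat h) z"

lemma rat_eval_simps [simp]:
  "rat_eval z (g + h) = rat_eval z g + rat_eval z h"
  "rat_eval z (g * h) = rat_eval z g * rat_eval z h"
  "rat_eval z (g - h) = rat_eval z g - rat_eval z h"
  "rat_eval z (g ^ k) = rat_eval z g ^ k"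
  "rat_eval z (- h) = - rat_eval z h"
  "rat_eval z (Polynomial.smult c h) = of_rat c * rat_eval z h"
  "rat_eval z (pCons c h) = of_rat c + z * rat_eval z h"
  "rat_eval z (Polynomial.monom c k) = of_rat c * z ^ k"
  "rat_eval z 0 = 0" "rat_eval z 1 = 1"
proof -
  interpret hom: map_poly_comm_ring_hom "of_rat :: rat \<Rightarrow> complex" ..
  show "rat_eval z (g + h) = rat_eval z g + rat_eval z h"
    "rat_eval z (g * h) = rat_eval z g * rat_eval z h"
    "rat_eval z (g - h) = rat_eval z g - rat_eval z h"
    "rat_eval z (g ^ k) = rat_eval z g ^ k"
    "rat_eval z (- h) = - rat_eval z h"
    "rat_eval z (Polynomial.smult c h) = of_rat c * rat_eval z h"
    "rat_eval z (pCons c h) = of_rat c + z * rat_eval z h"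
    "rat_eval z (Polynomial.monom c k) = of_rat c * z ^ k"
    "rat_eval z 0 = 0" "rat_eval z 1 = 1"
    by (simp_all add: rat_eval_def hom_distribs poly_monom of_rat_hom.map_poly_pCons_hom)
qed

lemma rat_eval_sum: "rat_eval z (\<Sum>i\<in>I. h i) = (\<Sum>i\<in>I. rat_eval z (h i))"
  by (induction I rule: infinite_finite_induct) auto

lemma rat_eval_of_int_poly: "rat_eval z (of_int_poly g) = poly (of_int_poly g) z"
proof -
  have "map_poly of_rat (of_int_poly g :: rat poly) = (of_int_poly g :: complex poly)"
    by (rule poly_eqI) (simp add: coeff_map_poly)
  thus ?thesis by (simp add: rat_eval_def)
qed

lemma rat_eval_pcompose:
  "rat_eval z (of_int_poly b \<circ>\<^sub>p h) = poly (of_int_poly b) (rat_eval z h)"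
  using rat_eval_of_int_poly[of "rat_eval z h" b]
  by (simp add: rat_eval_def of_rat_hom.map_poly_pcompose poly_pcompose)

lemma rat_poly_clear_denominators:
  fixes h :: "rat poly"
  obtains N g where "N > 0" "Polynomial.smult (of_int N) h = of_int_poly g"
proof -
  obtain N g where "rat_to_int_poly h = (N, g)" by fastforce
  note * = rat_to_int_poly[OF this]
  have "Polynomial.smult (of_int N) h = of_int_poly g" using *(2) by (subst *(1)) simp
  thus ?thesis using that *(2) by blast
qed

lemma rat_eval_eq_0_imp_int_root:
  assumes "h \<noteq> 0" "rat_eval z h = 0"
  obtains g where "g \<noteq> 0" "poly (of_int_poly g) z = 0" "Polynomial.degree g = Polynomial.degree h"
proof -
  obtain N g where N: "N > 0" and g: "Polynomial.smult (of_int N) h = of_int_poly g"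
    by (rule rat_poly_clear_denominators)
  have "poly (of_int_poly g) z = of_int N * rat_eval z h"
    using arg_cong[OF g, of "rat_eval z"] by (simp add: rat_eval_of_int_poly)
  moreover have "Polynomial.degree g = Polynomial.degree h"
    using arg_cong[OF g, of Polynomial.degree] N by simp
  moreover have "g \<noteq> 0" using g N assms(1) by auto
  ultimately show ?thesis using that assms(2) by auto
qed

text \<open>A zero constant coefficient would allow division by the variable, leaving a nonzero
  polynomial of smaller degree that vanishes at \<open>\<beta>\<close> and is divisible by the
  minimal one.\<close>

lemma coeff_0_min_int_poly_ne_0:
  assumes "b \<noteq> 0" "poly (of_int_poly b) \<beta> = 0" "\<beta> \<noteq> (0::complex)"
  shows "poly.coeff (min_int_poly \<beta>) 0 \<noteq> 0"
proof
  note dvd = min_int_poly_dvd_iff[OF assms(1,2)]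
  obtain c q where q: "min_int_poly \<beta> = pCons c q" by (metis pCons_cases)
  assume "poly.coeff (min_int_poly \<beta>) 0 = 0"
  hence c: "c = 0" using q by simp
  have "poly (of_int_poly (min_int_poly \<beta>)) \<beta> = 0" using dvd[of "min_int_poly \<beta>"] by simp
  hence "poly (of_int_poly q) \<beta> = 0" unfolding q c using assms(3) by (simp add: of_int_hom.map_poly_pCons_hom)
  hence d: "min_int_poly \<beta> dvd q" using dvd by blast
  have "min_int_poly \<beta> \<noteq> 0" using lead_coeff_min_int_poly[OF assms(1,2)] by auto
  hence "q \<noteq> 0" using q c by auto
  thus False using dvd_imp_degree_le[OF d] q by simp
qed

context
  fixes \<zeta> :: complex and f :: "int poly"
  assumes f_ne_0: "f \<noteq> 0" and f_root: "poly (of_int_poly f) \<zeta> = 0"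
begin

lemma rat_eval_low_degree:
  obtains r where "rat_eval \<zeta> h = rat_eval \<zeta> r" "r = 0 \<or> Polynomial.degree r < Polynomial.degree f"
proof -
  let ?F = "of_int_poly f :: rat poly"
  have "h = h div ?F * ?F + h mod ?F" by (rule div_mult_mod_eq[symmetric])
  hence "rat_eval \<zeta> h = rat_eval \<zeta> (h div ?F * ?F + h mod ?F)" by (rule arg_cong)
  also have "\<dots> = rat_eval \<zeta> (h mod ?F)"
    by (simp only: rat_eval_simps rat_eval_of_int_poly f_root) simp
  finally show ?thesis using that[of "h mod ?F"] degree_mod_less[of ?F h] f_ne_0 by auto
qed

text \<open>The powers \<open>1, \<beta>, \<dots>, \<beta>\<^sup>D\<close> are dependent, since they lie in the \<open>\<rat>\<close>-span of
  \<open>1, \<zeta>, \<dots>, \<zeta>\<^sup>D\<^sup>-\<^sup>1\<close>.\<close>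

lemma rat_eval_algebraic:
  obtains b where "b \<noteq> 0" "poly (of_int_poly b) (rat_eval \<zeta> h) = 0"
    "Polynomial.degree b \<le> Polynomial.degree f"
proof -
  let ?D = "Polynomial.degree f" and ?\<beta> = "rat_eval \<zeta> h"
  interpret V: vector_space "\<lambda>(q::rat) (z::complex). of_rat q * z"
    by unfold_locales (simp_all add: algebra_simps of_rat_add of_rat_mult)
  let ?T = "(\<lambda>i. \<zeta> ^ i) ` {..<?D}"
  have span: "rat_eval \<zeta> g \<in> V.span ?T" for g
  proof -
    obtain r where r: "rat_eval \<zeta> g = rat_eval \<zeta> r" "r = 0 \<or> Polynomial.degree r < ?D"
      by (rule rat_eval_low_degree)
    have "rat_eval \<zeta> r = (\<Sum>i\<le>Polynomial.degree r. of_rat (poly.coeff r i) * \<zeta> ^ i)"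
      by (simp add: rat_eval_def poly_altdef coeff_map_poly)
    also have "\<dots> \<in> V.span ?T"
    proof (cases "r = 0")
      case False
      thus ?thesis using r(2)
        by (intro V.span_sum V.span_scale V.span_base) auto
    qed (simp add: V.span_zero)
    finally show ?thesis using r by simp
  qed
  have "\<exists>g. g \<noteq> 0 \<and> Polynomial.degree g \<le> ?D \<and> rat_eval ?\<beta> g = 0"
  \<comment> \<open>Linear dependence is a property of the set of powers, so two equal powers are
    treated apart: there \<open>X^j - X^i\<close> is the relation.\<close>
  proof (cases "inj_on (\<lambda>j. ?\<beta> ^ j) {..?D}")
    case False
    then obtain i j where ij: "i < j" "j \<le> ?D" "?\<beta> ^ i = ?\<beta> ^ j"
      unfolding inj_on_def by (metis atMost_iff linorder_neqE_nat)
    let ?g = "Polynomial.monom 1 j - Polynomial.monom 1 i :: rat poly"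
    have "poly.coeff ?g j \<noteq> 0" using ij by simp
    hence "?g \<noteq> 0" by (metis coeff_0)
    moreover have "Polynomial.degree ?g \<le> ?D"
      using ij by (intro degree_diff_le) (auto intro: order_trans[OF degree_monom_le])
    moreover have "rat_eval ?\<beta> ?g = 0" using ij by simp
    ultimately show ?thesis by blast
  next
    case True
    let ?S = "(\<lambda>j. ?\<beta> ^ j) ` {..?D}"
    have "card ?S = Suc ?D" using True by (simp add: card_image)
    moreover have "card ?T \<le> ?D" using card_image_le[of "{..<?D}"] by simp
    moreover have "?S \<subseteq> V.span ?T" using span rat_eval_simps(4) by (metis image_subsetI)
    ultimately have "V.dependent ?S" using V.independent_span_bound[of ?T ?S] by fastforce
    then obtain u where u: "\<exists>v\<in>?S. u v \<noteq> 0" "(\<Sum>v\<in>?S. of_rat (u v) * v) = 0"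
      by (auto simp: V.dependent_finite)
    then obtain k where k: "k \<le> ?D" "u (?\<beta> ^ k) \<noteq> 0" by auto
    let ?g = "\<Sum>j\<le>?D. Polynomial.monom (u (?\<beta> ^ j)) j"
    have "poly.coeff ?g k = u (?\<beta> ^ k)" using k by (simp add: coeff_sum)
    hence "?g \<noteq> 0" using k by (metis coeff_0)
    moreover have "Polynomial.degree ?g \<le> ?D"
      by (intro degree_sum_le) (auto intro: order_trans[OF degree_monom_le])
    moreover have "rat_eval ?\<beta> ?g = 0"
      using u(2) True by (simp add: rat_eval_sum sum.reindex)
    ultimately show ?thesis by blast
  qed
  thus ?thesis using that rat_eval_eq_0_imp_int_root by metis
qed

lemma degree_min_int_poly_rat_eval_le:
  "Polynomial.degree (min_int_poly (rat_eval \<zeta> h)) \<le> Polynomial.degree f"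
proof -
  obtain b where b: "b \<noteq> 0" "poly (of_int_poly b) (rat_eval \<zeta> h) = 0"
    "Polynomial.degree b \<le> Polynomial.degree f" by (rule rat_eval_algebraic)
  have "min_int_poly (rat_eval \<zeta> h) dvd b" using min_int_poly_dvd_iff[OF b(1,2)] b(2) by blast
  thus ?thesis using b(1,3) dvd_imp_degree_le order_trans by blast
qed

text \<open>Writing the minimal polynomial of \<open>?\<beta>\<close> as \<open>c + X * q\<close>
  with \<open>c \<noteq> 0\<close> exhibits \<open>- q(?\<beta>) / c\<close> as the inverse;
  composing \<open>q\<close> with \<open>h\<close> makes it a polynomial in \<open>\<zeta>\<close>
  again.\<close>

lemma rat_eval_inverse:
  assumes "rat_eval \<zeta> h \<noteq> 0"
  obtains g where "rat_eval \<zeta> g = inverse (rat_eval \<zeta> h)"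
proof -
  let ?\<beta> = "rat_eval \<zeta> h"
  obtain b where b: "b \<noteq> 0" "poly (of_int_poly b) ?\<beta> = 0" by (rule rat_eval_algebraic)
  obtain c q where q: "min_int_poly ?\<beta> = pCons c q" by (metis pCons_cases)
  have c: "c \<noteq> 0" using coeff_0_min_int_poly_ne_0[OF b assms] q by simp
  have "poly (of_int_poly (min_int_poly ?\<beta>)) ?\<beta> = 0" using min_int_poly_dvd_iff[OF b, of "min_int_poly ?\<beta>"] by simp
  hence "of_int c + ?\<beta> * poly (of_int_poly q) ?\<beta> = 0"
    unfolding q by (simp add: of_int_hom.map_poly_pCons_hom)
  hence "?\<beta> * (- (1 / of_int c) * poly (of_int_poly q) ?\<beta>) = 1"
    using c by (simp add: field_simps add_eq_0_iff)
  hence "- (1 / of_int c) * poly (of_int_poly q) ?\<beta> = inverse ?\<beta>"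
    by (metis inverse_unique)
  moreover have "rat_eval \<zeta> (Polynomial.smult (- (1 / of_int c)) (of_int_poly q \<circ>\<^sub>p h)) =
      - (1 / of_int c) * poly (of_int_poly q) ?\<beta>"
    by (simp add: rat_eval_pcompose of_rat_minus of_rat_divide)
  ultimately show ?thesis using that by metis
qed

text \<open>Polynomial expressions in an algebraic number are closed under inverses, the only
  nontrivial closure property, so they exhaust the field it generates.\<close>

lemma carrier_rat_adjoin_subset: "carrier (rat_adjoin \<zeta>) \<subseteq> range (rat_eval \<zeta>)"
proof
  let ?R = "ring_of_type_algebra :: complex ring"
  interpret R: field ?R by (rule field_from_type_algebra)
  fix z assume "z \<in> carrier (rat_adjoin \<zeta>)"
  hence "z \<in> generate_field ?R {\<zeta>}" by (simp add: rat_adjoin_def)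
  thus "z \<in> range (rat_eval \<zeta>)"
  proof (induction rule: generate_field.induct)
    case one
    have "rat_eval \<zeta> 1 = 1" by simp
    thus ?case by (metis rangeI ring_of_type_algebra_def monoid.select_convs(2))
  next
    case (incl z)
    have "rat_eval \<zeta> [:0, 1:] = \<zeta>" by simp
    thus ?case using incl by (metis rangeI singletonD)
  next
    case (a_inv z)
    have "\<ominus>\<^bsub>?R\<^esub> z = - z" by (rule R.minus_equality) (auto simp: ring_of_type_algebra_def)
    thus ?case using a_inv by (metis rangeE rangeI rat_eval_simps(5))
  next
    case (m_inv z)
    have z0: "z \<noteq> 0" using m_inv by (simp add: ring_of_type_algebra_def)
    have "inverse z = inv\<^bsub>?R\<^esub> z"
      by (rule R.inv_unique') (use z0 in \<open>auto simp: ring_of_type_algebra_def\<close>)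
    moreover have "inverse z \<in> range (rat_eval \<zeta>)"
      using m_inv z0 rat_eval_inverse by (metis rangeE rangeI)
    ultimately show ?case by simp
  next
    case (eng_add y z)
    thus ?case by (auto simp: ring_of_type_algebra_def) (metis rangeI rat_eval_simps(1))
  next
    case (eng_mult y z)
    thus ?case by (auto simp: ring_of_type_algebra_def) (metis rangeI rat_eval_simps(2))
  qed
qed

end

section \<open>Roots of unity\<close>

abbreviation unity_poly :: "nat \<Rightarrow> int poly" where
  "unity_poly k \<equiv> Polynomial.monom 1 k - 1"

lemma poly_unity_poly: "poly (of_int_poly (unity_poly k)) (z::'a::comm_ring_1) = z ^ k - 1"
  by (simp add: hom_distribs poly_monom)

lemma unity_poly_ne_0:
  assumes "k > 0"
  shows "unity_poly k \<noteq> 0"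
proof -
  have "poly.coeff (unity_poly k) k = 1" using assms by simp
  thus ?thesis by (metis coeff_0 zero_neq_one)
qed

lemma lead_coeff_unity_poly:
  assumes "k > 0"
  shows "Polynomial.lead_coeff (unity_poly k) = 1"
proof -
  have "Polynomial.degree (- 1 :: int poly) < Polynomial.degree (Polynomial.monom 1 k :: int poly)"
    using assms by (simp add: degree_monom_eq)
  from lead_coeff_add_le[OF this] show ?thesis using assms by (simp add: degree_monom_eq)
qed

context
  fixes m :: nat and \<zeta> :: complex
  assumes m_pos: "m > 0" and prim: "primitive_root_of_unity m \<zeta>"
begin

lemma unity_poly_root: "poly (of_int_poly (unity_poly m)) \<zeta> = 0"
  using prim by (simp add: poly_unity_poly primitive_root_of_unity_def)

lemmas unity_poly_root_witness = unity_poly_ne_0[OF m_pos] unity_poly_root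

lemma min_int_poly_dvd_unity_poly_iff: "min_int_poly \<zeta> dvd unity_poly k \<longleftrightarrow> \<zeta> ^ k = 1"
  using min_int_poly_dvd_iff[OF unity_poly_root_witness, of "unity_poly k"] by (simp add: poly_unity_poly)

lemma min_int_poly_dvd_unity_poly: "min_int_poly \<zeta> dvd unity_poly m"
  using prim min_int_poly_dvd_unity_poly_iff by (simp add: primitive_root_of_unity_def)

lemma monic_min_int_poly_root_of_unity: "Polynomial.lead_coeff (min_int_poly \<zeta>) = 1"
proof -
  obtain q where "unity_poly m = min_int_poly \<zeta> * q" using min_int_poly_dvd_unity_poly by auto
  hence "Polynomial.lead_coeff (min_int_poly \<zeta>) dvd 1"
    using lead_coeff_unity_poly[OF m_pos] lead_coeff_mult by (metis dvd_triv_left)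
  thus ?thesis using lead_coeff_min_int_poly[OF unity_poly_root_witness] by (simp add: zdvd1_eq)
qed

text \<open>Irreducibility makes every conjugate of \<open>\<zeta>\<close> a primitive \<open>m\<close>-th root of unity.\<close>

lemma conjugate_power_eq_1_imp:
  assumes "poly (of_int_poly (min_int_poly \<zeta>)) (z::complex) = 0" "z ^ k = 1"
  shows "\<zeta> ^ k = 1"
proof -
  note irr = irreducible_min_int_poly[OF unity_poly_root_witness]
  have f0: "min_int_poly \<zeta> \<noteq> 0" using irr by auto
  note dvd = min_int_poly_dvd_iff[OF f0 assms(1)]
  obtain u where u: "min_int_poly \<zeta> = min_int_poly z * u" using dvd assms(1) by blast
  have "\<not> is_unit (min_int_poly z)"
    using irreducible_min_int_poly[OF f0 assms(1)] by (rule irreducible_not_unit)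
  hence "is_unit u" using Factorial_Ring.irreducibleD[OF irr u] by blast
  moreover have "min_int_poly z dvd unity_poly k"
    using dvd[of "unity_poly k"] assms(2) by (simp add: poly_unity_poly)
  ultimately have "min_int_poly \<zeta> dvd unity_poly k" unfolding u by (simp add: mult_unit_dvd_iff)
  thus ?thesis by (simp add: min_int_poly_dvd_unity_poly_iff)
qed

text \<open>Counting: the powers of \<open>\<zeta>\<close> with exponents from \<open>1\<close> to
  \<open>m\<close> are pairwise distinct solutions of \<open>z ^ m = 1\<close>, which has only
  \<open>m\<close> solutions.\<close>

lemma root_of_unity_eq_power:
  assumes "z ^ m = 1"
  obtains j where "j \<in> {0<..m}" "z = \<zeta> ^ j"
proof -
  have ord: "\<zeta> ^ m = 1" "\<And>k. 0 < k \<Longrightarrow> k < m \<Longrightarrow> \<zeta> ^ k \<noteq> 1"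
    using prim by (auto simp: primitive_root_of_unity_def)
  have z0: "\<zeta> \<noteq> 0" using ord(1) m_pos by (auto simp: power_0_left)
  have "inj_on (\<lambda>j. \<zeta> ^ j) {0<..m}"
  proof (rule linorder_inj_onI)
    fix i j assume ij: "i < j" "i \<in> {0<..m}" "j \<in> {0<..m}"
    show "\<zeta> ^ i \<noteq> \<zeta> ^ j"
    proof
      assume "\<zeta> ^ i = \<zeta> ^ j"
      also have "\<zeta> ^ j = \<zeta> ^ i * \<zeta> ^ (j - i)" using ij by (simp flip: power_add)
      finally have "\<zeta> ^ (j - i) = 1" using z0 by simp
      moreover have "0 < j - i" "j - i < m" using ij by auto
      ultimately show False using ord(2) by blast
    qed
  qed auto
  hence "card ((\<lambda>j. \<zeta> ^ j) ` {0<..m}) = m" by (simp add: card_image)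
  moreover have "(\<lambda>j. \<zeta> ^ j) ` {0<..m} \<subseteq> {z. z ^ m = 1}"
  proof safe
    fix j show "(\<zeta> ^ j) ^ m = 1" using ord(1) by (metis power_commutes power_mult mult.commute power_one)
  qed
  moreover have "card {z::complex. z ^ m = 1} = m" using m_pos by (intro card_nth_roots) auto
  ultimately have "(\<lambda>j. \<zeta> ^ j) ` {0<..m} = {z. z ^ m = 1}"
    using m_pos by (intro card_subset_eq finite_nth_roots) auto
  thus ?thesis using assms that by blast
qed

lemma conjugate_power_m:
  assumes "poly (of_int_poly (min_int_poly \<zeta>)) (z::complex) = 0"
  shows "z ^ m = 1"
proof -
  obtain q where "unity_poly m = min_int_poly \<zeta> * q" using min_int_poly_dvd_unity_poly by auto
  hence "poly (of_int_poly (unity_poly m)) z = 0" using assms by (simp only: hom_distribs poly_mult) simp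
  thus ?thesis by (simp add: poly_unity_poly)
qed

text \<open>The degree is the number of complex zeros, since \<open>X^m - 1\<close> has no double
  ones, and every zero is a power \<open>\<zeta> ^ j\<close> with \<open>j\<close> prime to
  \<open>m\<close>, as conjugates of \<open>\<zeta>\<close> are primitive too.\<close>

lemma degree_min_int_poly_root_of_unity_le: "Polynomial.degree (min_int_poly \<zeta>) \<le> totient m"
proof -
  let ?F = "of_int_poly (min_int_poly \<zeta>) :: complex poly"
  obtain q where q: "unity_poly m = min_int_poly \<zeta> * q" using min_int_poly_dvd_unity_poly by auto
  define G where "G = (of_int_poly q :: complex poly)"
  have FG: "Polynomial.monom 1 m - 1 = ?F * G"
    using arg_cong[OF q, of "of_int_poly :: _ \<Rightarrow> complex poly"] unfolding G_def by (simp add: hom_distribs)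
  have F0: "?F \<noteq> 0" using irreducible_min_int_poly[OF unity_poly_root_witness] by auto
  have "rsquarefree ?F" unfolding rsquarefree_roots
  proof (intro allI notI)
    fix a assume a: "poly ?F a = 0 \<and> poly (pderiv ?F) a = 0"
    have "poly (pderiv (Polynomial.monom 1 m - 1)) a = poly (pderiv (?F * G)) a" by (simp only: FG)
    hence "of_nat m * a ^ (m - 1) = 0"
      using a by (simp add: pderiv_diff pderiv_monom poly_monom pderiv_mult)
    hence "a = 0" using m_pos by simp
    moreover have "a ^ m = 1" using a by (intro conjugate_power_m) simp
    ultimately show False using m_pos by (simp add: power_0_left)
  qed
  hence "Polynomial.degree (min_int_poly \<zeta>) = card {x. poly ?F x = 0}"
    using rsquarefree_card_degree[OF F0] by simp
  also have "{x. poly ?F x = 0} \<subseteq> (\<lambda>j. \<zeta> ^ j) ` totatives m"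
  proof
    fix z assume "z \<in> {x. poly ?F x = 0}"
    hence z: "poly ?F z = 0" by simp
    obtain j where j: "j \<in> {0<..m}" "z = \<zeta> ^ j"
      using root_of_unity_eq_power conjugate_power_m[OF z] by metis
    have "Rings.coprime j m"
    proof (rule ccontr)
      assume "\<not> Rings.coprime j m"
      hence g1: "gcd j m \<noteq> 1" using coprime_iff_gcd_eq_1 by blast
      define g where "g = gcd j m"
      have g: "g > 1" "g dvd j" "g dvd m" using g1 m_pos unfolding g_def by (auto simp: nat_neq_iff)
      then obtain a b where ab: "j = g * a" "m = g * b" by (auto elim!: dvdE)
      \<comment> \<open>With \<open>g = gcd j m > 1\<close> and \<open>b = m div g\<close> the zero
        satisfies \<open>z ^ b = 1\<close>; its conjugate \<open>\<zeta>\<close> would do so as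
        well, against its order \<open>m\<close>.\<close>
      have "z ^ b = (\<zeta> ^ m) ^ a" unfolding j(2) ab by (simp flip: power_mult add: ac_simps)
      hence "z ^ b = 1" using prim by (simp add: primitive_root_of_unity_def)
      hence "\<zeta> ^ b = 1" by (rule conjugate_power_eq_1_imp[OF z])
      moreover have "0 < b" "b < m" using ab g m_pos by auto
      ultimately show False using prim by (auto simp: primitive_root_of_unity_def)
    qed
    thus "z \<in> (\<lambda>j. \<zeta> ^ j) ` totatives m" using j by (auto simp: totatives_def)
  qed
  hence "card {x. poly ?F x = 0} \<le> card ((\<lambda>j. \<zeta> ^ j) ` totatives m)" by (intro card_mono) auto
  also have "\<dots> \<le> totient m" unfolding totient_def by (rule card_image_le) simp
  finally show ?thesis .
qed

end

section \<open>Congruences of powers and zeros modulo prime powers\<close>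

text \<open>The sum is the cofactor of \<open>a - b\<close> in \<open>a ^ n - b ^ n\<close>. It is
  used with \<open>n = p\<close>, where it is divisible by \<open>p\<close>, and with
  \<open>n = m\<close>, where it is a unit modulo \<open>p\<close>.\<close>

lemma sum_mixed_powers_cong:
  fixes a b q :: int
  assumes "[a = b] (mod q)"
  shows "[(\<Sum>i<n. b ^ (n - Suc i) * a ^ i) = int n * b ^ (n - 1)] (mod q)"
proof -
  have "[(\<Sum>i<n. b ^ (n - Suc i) * a ^ i) = (\<Sum>i<n. b ^ (n - 1))] (mod q)"
  proof (rule cong_sum)
    fix i assume i: "i \<in> {..<n}"
    have "[b ^ (n - Suc i) * a ^ i = b ^ (n - Suc i) * b ^ i] (mod q)"
      using assms by (intro cong_mult cong_pow cong_refl)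
    also have "b ^ (n - Suc i) * b ^ i = b ^ (n - 1)"
      using i by (simp flip: power_add)
    finally show "[b ^ (n - Suc i) * a ^ i = b ^ (n - 1)] (mod q)" .
  qed
  thus ?thesis by simp
qed

text \<open>Each \<open>p\<close>-th power gains a factor \<open>p\<close>: the cofactor of
  \<open>?x - ?y\<close> in \<open>?x ^ p - ?y ^ p\<close> is congruent to
  \<open>p * ?y ^ (p - 1)\<close>.\<close>

lemma cong_power_prime_lift:
  fixes a b :: int
  assumes "[a = b] (mod int p)"
  shows "[a ^ (p ^ j) = b ^ (p ^ j)] (mod int p ^ Suc j)"
proof (induction j)
  case 0
  thus ?case using assms by simp
next
  case (Suc j)
  let ?x = "a ^ (p ^ j)" and ?y = "b ^ (p ^ j)"
  have "[?x = ?y] (mod int p)" using assms by (rule cong_pow)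
  hence "[(\<Sum>i<p. ?y ^ (p - Suc i) * ?x ^ i) = int p * ?y ^ (p - 1)] (mod int p)"
    by (rule sum_mixed_powers_cong)
  hence "int p dvd (\<Sum>i<p. ?y ^ (p - Suc i) * ?x ^ i)"
    by (simp add: cong_dvd_iff)
  moreover have "int p ^ Suc j dvd ?x - ?y" using Suc by (simp add: cong_iff_dvd_diff)
  ultimately have "int p ^ Suc j * int p dvd (?x - ?y) * (\<Sum>i<p. ?y ^ (p - Suc i) * ?x ^ i)"
    by (intro mult_dvd_mono)
  also have "\<dots> = ?x ^ p - ?y ^ p" by (rule power_diff_sumr2[symmetric])
  finally show ?case by (simp add: cong_iff_dvd_diff power_mult[symmetric] mult.commute)
qed

lemma poly_cong:
  fixes g :: "int poly"
  assumes "[a = b] (mod q)"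
  shows "[poly g a = poly g b] (mod q)"
  by (induction g) (auto intro!: cong_add cong_mult assms)

text \<open>Lagrange's bound over the field with \<open>p\<close> elements, phrased with pairwise
  incongruent integers. Splitting off a zero \<open>r\<close> by synthetic division keeps the
  leading coefficient, and \<open>p\<close> divides \<open>x - r\<close> or the quotient at
  \<open>x\<close>.\<close>

lemma card_roots_mod_prime_le:
  fixes g :: "int poly"
  assumes p: "Factorial_Ring.prime (p::int)"
  shows "\<not> p dvd Polynomial.lead_coeff g \<Longrightarrow> finite Y \<Longrightarrow> (\<forall>x\<in>Y. p dvd poly g x) \<Longrightarrow>
    (\<forall>x\<in>Y. \<forall>y\<in>Y. p dvd x - y \<longrightarrow> x = y) \<Longrightarrow> card Y \<le> Polynomial.degree g"
proof (induction "Polynomial.degree g" arbitrary: g Y)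
  case 0
  then obtain c where "g = [:c:]" by (metis degree_eq_zeroE)
  hence "Y = {}" using 0 by auto
  thus ?case by simp
next
  case (Suc n)
  show ?case
  proof (cases "Y = {}")
    case False
    then obtain r where r: "r \<in> Y" by blast
    define q where "q = synthetic_div g r"
    have g: "g = [:- r, 1:] * q + [:poly g r:]"
      unfolding q_def by (rule synthetic_div_correct'[symmetric])
    have dq: "Polynomial.degree q = n" using Suc(2) by (simp add: q_def degree_synthetic_div)
    have q0: "q \<noteq> 0"
    proof
      assume "q = 0"
      hence "Polynomial.degree g = 0" using g by (metis add_0 degree_pCons_0 mult_zero_right)
      thus False using Suc(2) by simp
    qed
    have "Polynomial.lead_coeff g = Polynomial.lead_coeff ([:- r, 1:] * q)"
    proof -
      have "Polynomial.degree [:poly g r:] < Polynomial.degree ([:- r, 1:] * q)"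
        using q0 by (subst degree_mult_eq) auto
      from lead_coeff_add_le[OF this] show ?thesis using g by (metis add.commute)
    qed
    hence lc: "Polynomial.lead_coeff g = Polynomial.lead_coeff q" by (simp add: lead_coeff_mult del: mult_pCons_left)
    have "card (Y - {r}) \<le> Polynomial.degree q"
    proof (rule Suc(1))
      show "\<forall>x\<in>Y - {r}. p dvd poly q x"
      proof
        fix x assume x: "x \<in> Y - {r}"
        have "poly g x - poly g r = (x - r) * poly q x"
          by (subst g) (simp add: algebra_simps)
        moreover have "p dvd poly g x - poly g r" using x r Suc by auto
        ultimately have "p dvd x - r \<or> p dvd poly q x" using prime_dvd_multD[OF p] by metis
        thus "p dvd poly q x" using x r Suc by blast
      qed
    qed (use Suc lc dq in auto)
    thus ?thesis using dq Suc(2) r Suc(4) by simp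
  qed simp
qed

lemma poly_unity_poly_int: "poly (unity_poly k) (x::int) = x ^ k - 1"
  by (simp add: poly_monom)

context
  fixes m :: nat and \<zeta> :: complex
  assumes m_pos: "m > 0" and prim: "primitive_root_of_unity m \<zeta>"
begin

lemma poly_min_int_poly_dvd: "poly (min_int_poly \<zeta>) x dvd x ^ m - 1"
proof -
  obtain q where "unity_poly m = min_int_poly \<zeta> * q"
    using min_int_poly_dvd_unity_poly[OF m_pos prim] by auto
  hence "poly (unity_poly m) x = poly (min_int_poly \<zeta>) x * poly q x" by simp
  thus ?thesis unfolding poly_unity_poly_int by simp
qed

text \<open>Otherwise \<open>x ^ m\<close> would be both \<open>0\<close> and \<open>1\<close>
  modulo \<open>p\<close>. For arguments \<open>m * a\<close> this also excludes the primes dividing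
  \<open>m\<close>.\<close>

lemma dvd_poly_min_int_poly_imp_not_dvd:
  assumes "Factorial_Ring.prime (p::int)" "p dvd poly (min_int_poly \<zeta>) x"
  shows "\<not> p dvd x"
proof
  assume "p dvd x"
  hence "p dvd x ^ m" using m_pos by (simp add: dvd_power_le prime_dvd_power_iff assms(1))
  moreover have "p dvd x ^ m - 1" by (rule dvd_trans[OF assms(2) poly_min_int_poly_dvd])
  ultimately have "p dvd x ^ m - (x ^ m - 1)" by (rule dvd_diff)
  hence "p dvd 1" by simp
  thus False using assms(1) by (simp add: not_prime_unit)
qed

text \<open>The Teichmueller sequence \<open>r, r\<^sup>p, r\<^sup>p\<^sup>2, \<dots>\<close> converges \<open>p\<close>-adically to a zero of the
  minimal polynomial of \<open>\<zeta>\<close>; the cofactor in \<open>x\<^sup>m - 1\<close> stays a unit because \<open>x\<^sup>m - 1\<close> is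
  separable modulo \<open>p\<close>.\<close>

lemma
  assumes p: "Factorial_Ring.prime p" and pm: "\<not> p dvd m"
    and root: "int p dvd poly (min_int_poly \<zeta>) (int r)"
  shows Teichmueller_root: "int p ^ Suc j dvd poly (min_int_poly \<zeta>) (int r ^ (p ^ j))"
    and Teichmueller_Cauchy: "int p ^ Suc j dvd int r ^ (p ^ Suc j) - int r ^ (p ^ j)"
proof -
  let ?f = "min_int_poly \<zeta>" and ?x = "int r ^ (p ^ j)"
  have pint: "Factorial_Ring.prime (int p)" using p by simp
  have "\<not> int p dvd int r" using dvd_poly_min_int_poly_imp_not_dvd[OF pint root] .
  hence "\<not> p dvd r" by simp
  hence "[r ^ (p - 1) = 1] (mod p)" using p by (intro fermat_theorem)
  hence "[r ^ (p - 1) * r = 1 * r] (mod p)" by (intro cong_mult cong_refl)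
  moreover have "r ^ (p - 1) * r = r ^ p"
    using prime_gt_0_nat[OF p] by (metis power_minus_mult)
  ultimately have "[r ^ p = r] (mod p)" by simp
  hence fermat: "[int r ^ p = int r] (mod int p)"
    using cong_int_iff[of "r ^ p" r p] by simp
  have "[(int r ^ p) ^ (p ^ j) = int r ^ (p ^ j)] (mod int p ^ Suc j)"
    using fermat by (rule cong_power_prime_lift)
  thus "int p ^ Suc j dvd int r ^ (p ^ Suc j) - ?x"
    by (simp add: cong_iff_dvd_diff power_mult)
  \<comment> \<open>Fermat keeps all terms of the sequence in the residue class of \<open>r\<close>,
    so they remain zeros modulo \<open>p\<close>.\<close>
  have xr: "[int r ^ (p ^ i) = int r] (mod int p)" for i
  proof (induction i)
    case (Suc i)
    have "[(int r ^ (p ^ i)) ^ p = int r ^ p] (mod int p)" using Suc by (rule cong_pow)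
    also note fermat
    finally show ?case by (simp add: power_mult[symmetric] mult.commute)
  qed simp
  have px: "\<not> int p dvd ?x" using \<open>\<not> int p dvd int r\<close> prime_dvd_power[OF pint] by metis
  have fx: "int p dvd poly ?f ?x" using poly_cong[OF xr[of j], of ?f] root by (simp add: cong_dvd_iff)
  obtain q where q: "unity_poly m = ?f * q" using min_int_poly_dvd_unity_poly[OF m_pos prim] by auto
  \<comment> \<open>\<open>r ^ m = 1\<close> holds modulo \<open>p\<close> already; raising it to
    the power \<open>p ^ j\<close> lifts it to the modulus \<open>p ^ Suc j\<close>.\<close>
  have "int p dvd int r ^ m - 1" by (rule dvd_trans[OF root poly_min_int_poly_dvd])
  hence "[int r ^ m = 1] (mod int p)" by (simp add: cong_iff_dvd_diff)
  from cong_power_prime_lift[OF this, of j]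
  have "int p ^ Suc j dvd ?x ^ m - 1" by (simp add: cong_iff_dvd_diff power_mult[symmetric] mult.commute)
  moreover have "?x ^ m - 1 = poly ?f ?x * poly q ?x"
    using arg_cong[OF q, of "\<lambda>g. poly g ?x"] by (simp only: poly_unity_poly_int poly_mult)
  ultimately have dvd: "int p ^ Suc j dvd poly ?f ?x * poly q ?x" by simp
  have "\<not> int p dvd poly q ?x"
  proof
    assume qx: "int p dvd poly q ?x"
    have "poly (pderiv (unity_poly m)) ?x = int m * ?x ^ (m - 1)"
      by (simp add: pderiv_diff pderiv_monom poly_monom)
    moreover have "poly (pderiv (unity_poly m)) ?x = poly ?f ?x * poly (pderiv q) ?x + poly q ?x * poly (pderiv ?f) ?x"
      unfolding q by (simp add: pderiv_mult)
    moreover have "int p dvd poly ?f ?x * poly (pderiv q) ?x + poly q ?x * poly (pderiv ?f) ?x"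
      using fx qx by (intro dvd_add dvd_mult2)
    ultimately have "int p dvd int m * ?x ^ (m - 1)" by metis
    thus False using pm px prime_dvd_power[OF pint] prime_dvd_multD[OF pint] by (metis int_dvd_int_iff)
  qed
  hence "Rings.coprime (int p ^ Suc j) (poly q ?x)"
    by (intro coprime_power_left_iff[THEN iffD2] disjI1 prime_imp_coprime[OF pint])
  thus "int p ^ Suc j dvd poly ?f ?x" using dvd by (simp add: coprime_dvd_mult_left_iff)
qed

text \<open>Uniqueness in Hensel's lemma, read off from \<open>X^m - 1\<close>: the cofactor of
  \<open>?x - ?y\<close> in \<open>?x ^ m - ?y ^ m\<close> is \<open>m * ?y ^ (m - 1)\<close> modulo
  \<open>p\<close>, hence prime to \<open>p\<close>, and so is the factor \<open>m\<close> of
  \<open>?x - ?y\<close>. All of \<open>p ^ e\<close> goes into \<open>a - b\<close>.\<close>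

lemma roots_mod_prime_power_unique:
  assumes p: "Factorial_Ring.prime p" and pm: "\<not> p dvd m" and e: "e > 0"
    and a: "int p ^ e dvd poly (min_int_poly \<zeta>) (int m * a)"
    and b: "int p ^ e dvd poly (min_int_poly \<zeta>) (int m * b)"
    and ab: "int p dvd a - b"
  shows "int p ^ e dvd a - b"
proof -
  let ?x = "int m * a" and ?y = "int m * b"
  have pint: "Factorial_Ring.prime (int p)" using p by simp
  have "int p ^ e dvd (?x ^ m - 1) - (?y ^ m - 1)"
    by (intro dvd_diff dvd_trans[OF a poly_min_int_poly_dvd] dvd_trans[OF b poly_min_int_poly_dvd])
  also have "\<dots> = ?x ^ m - ?y ^ m" by simp
  also have "\<dots> = (?x - ?y) * (\<Sum>i<m. ?y ^ (m - Suc i) * ?x ^ i)" by (rule power_diff_sumr2)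
  finally have dvd: "int p ^ e dvd (a - b) * (int m * (\<Sum>i<m. ?y ^ (m - Suc i) * ?x ^ i))"
    by (simp add: algebra_simps)
  have "int p dvd poly (min_int_poly \<zeta>) ?y" using b e by (metis dvd_power dvd_trans)
  hence py: "\<not> int p dvd ?y" by (rule dvd_poly_min_int_poly_imp_not_dvd[OF pint])
  have "[?x = ?y] (mod int p)"
    using ab by (simp add: cong_iff_dvd_diff flip: right_diff_distrib)
  hence "[(\<Sum>i<m. ?y ^ (m - Suc i) * ?x ^ i) = int m * ?y ^ (m - 1)] (mod int p)"
    by (rule sum_mixed_powers_cong)
  moreover have "\<not> int p dvd int m * ?y ^ (m - 1)"
    using pm py pint prime_dvd_power[OF pint] prime_dvd_multD[OF pint] by (metis int_dvd_int_iff)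
  ultimately have "\<not> int p dvd (\<Sum>i<m. ?y ^ (m - Suc i) * ?x ^ i)" by (simp add: cong_dvd_iff)
  hence "\<not> int p dvd int m * (\<Sum>i<m. ?y ^ (m - Suc i) * ?x ^ i)"
    using pm pint by (auto simp: prime_dvd_mult_iff)
  hence "Rings.coprime (int p ^ e) (int m * (\<Sum>i<m. ?y ^ (m - Suc i) * ?x ^ i))"
    by (intro coprime_power_left_iff[THEN iffD2] disjI1 prime_imp_coprime[OF pint])
  thus ?thesis using dvd by (simp add: coprime_dvd_mult_left_iff)
qed

text \<open>The range is cut into blocks by \<open>a div p ^ e\<close>. In a block, zeros congruent
  modulo \<open>p\<close> agree modulo \<open>p ^ e\<close> and hence coincide, so Lagrange's bound
  limits every block to the degree. Block numbers start at \<open>0\<close>, whence the summand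
  \<open>1\<close>.\<close>

lemma card_roots_mod_prime_power_le:
  assumes p: "Factorial_Ring.prime p" and pm: "\<not> p dvd m" and e: "e > 0"
  shows "card {a\<in>{1..A}. int p ^ e dvd poly (min_int_poly \<zeta>) (int m * int a)} \<le>
    Polynomial.degree (min_int_poly \<zeta>) * (A div p ^ e + 1)"
proof -
  let ?f = "min_int_poly \<zeta>"
  let ?R = "\<lambda>t. {a\<in>{1..A}. int p ^ e dvd poly ?f (int m * int a) \<and> a div p ^ e = t}"
  have pint: "Factorial_Ring.prime (int p)" using p by simp
  have block: "card (?R t) \<le> Polynomial.degree ?f" for t
  proof -
    have same: "a = b" if "a \<in> ?R t" "b \<in> ?R t" "int p dvd int m * int a - int m * int b" for a b
    proof -
      have "int p dvd int m * (int a - int b)" using that(3) by (simp add: right_diff_distrib)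
      hence "int p dvd int a - int b" using pm pint by (auto simp: prime_dvd_mult_iff)
      hence "int p ^ e dvd int a - int b"
        using that(1,2) by (intro roots_mod_prime_power_unique[OF p pm e]) auto
      hence "[int a = int b] (mod int (p ^ e))" by (simp add: cong_iff_dvd_diff)
      hence "a mod p ^ e = b mod p ^ e" by (simp only: cong_int_iff) (simp add: cong_def)
      moreover have "a div p ^ e = b div p ^ e" using that by simp
      ultimately show ?thesis by (metis div_mult_mod_eq)
    qed
    have "inj_on (\<lambda>a. int m * int a) (?R t)" using m_pos by (auto simp: inj_on_def)
    hence "card (?R t) = card ((\<lambda>a. int m * int a) ` ?R t)" by (simp add: card_image)
    also have "\<dots> \<le> Polynomial.degree ?f"
    proof (rule card_roots_mod_prime_le[OF pint])
      show "\<not> int p dvd Polynomial.lead_coeff ?f"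
        using monic_min_int_poly_root_of_unity[OF m_pos prim] prime_gt_1_nat[OF p] by simp
      have "int p dvd int p ^ e" using e by simp
      thus "\<forall>x\<in>(\<lambda>a. int m * int a) ` ?R t. int p dvd poly ?f x" by (auto intro: dvd_trans)
      show "\<forall>x\<in>(\<lambda>a. int m * int a) ` ?R t. \<forall>y\<in>(\<lambda>a. int m * int a) ` ?R t. int p dvd x - y \<longrightarrow> x = y"
        using same by blast
    qed simp
    finally show ?thesis .
  qed
  have "{a\<in>{1..A}. int p ^ e dvd poly ?f (int m * int a)} = (\<Union>t\<in>{0..A div p ^ e}. ?R t)"
    by (auto intro: div_le_mono)
  hence "card {a\<in>{1..A}. int p ^ e dvd poly ?f (int m * int a)} \<le> (\<Sum>t\<in>{0..A div p ^ e}. card (?R t))"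
    by (simp only:) (rule card_UN_le, simp)
  also have "\<dots> \<le> (\<Sum>t\<in>{0..A div p ^ e}. Polynomial.degree ?f)" by (intro sum_mono block)
  finally show ?thesis by (simp add: mult.commute)
qed

end

section \<open>Primes dividing values of the minimal polynomial\<close>

lemma multiplicity_eq_card:
  fixes n p E :: nat
  assumes "Factorial_Ring.prime p" "n > 0" "multiplicity p n \<le> E"
  shows "multiplicity p n = card {e\<in>{1..E}. p ^ e dvd n}"
proof -
  have "p ^ e dvd n \<longleftrightarrow> e \<le> multiplicity p n" for e
    using assms by (intro power_dvd_iff_le_multiplicity) auto
  hence "{e\<in>{1..E}. p ^ e dvd n} = {e\<in>{1..E}. e \<le> multiplicity p n}" by (simp only:)
  also have "\<dots> = {1..multiplicity p n}" using assms(3) by auto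
  finally have *: "{e\<in>{1..E}. p ^ e dvd n} = {1..multiplicity p n}" .
  show ?thesis unfolding * by simp
qed

text \<open>Double counting of the pairs \<open>(a, e)\<close> with \<open>p ^ e\<close> dividing
  \<open>g a\<close>, as in Legendre's formula; any \<open>E\<close> bounding the exponents makes
  the truncated sum exact.\<close>

lemma multiplicity_prod_eq_sum_card:
  fixes g :: "nat \<Rightarrow> nat"
  assumes p: "Factorial_Ring.prime p"
    and pos: "\<And>a. a \<in> {1..A} \<Longrightarrow> g a > 0" and E: "\<And>a. a \<in> {1..A} \<Longrightarrow> multiplicity p (g a) \<le> E"
  shows "multiplicity p (\<Prod>a=1..A. g a) = (\<Sum>e=1..E. card {a\<in>{1..A}. p ^ e dvd g a})"
proof -
  have "multiplicity p (\<Prod>a=1..A. g a) = (\<Sum>a=1..A. multiplicity p (g a))"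
  proof (rule prime_elem_multiplicity_prod_distrib)
    show "0 \<notin> g ` {1..A}" using pos by (metis imageE less_irrefl)
  qed (use p in auto)
  also have "\<dots> = (\<Sum>a=1..A. card {e\<in>{1..E}. p ^ e dvd g a})"
    using multiplicity_eq_card[OF p pos E] by simp
  also have "\<dots> = (\<Sum>a=1..A. \<Sum>e=1..E. if p ^ e dvd g a then 1 else 0)"
    by (simp add: sum.If_cases Int_def)
  also have "\<dots> = (\<Sum>e=1..E. \<Sum>a=1..A. if p ^ e dvd g a then 1 else 0)" by (rule sum.swap)
  also have "\<dots> = (\<Sum>e=1..E. card {a\<in>{1..A}. p ^ e dvd g a})"
    by (simp add: sum.If_cases Int_def)
  finally show ?thesis .
qed

lemma card_multiples:
  assumes "(q::nat) > 0"
  shows "card {a\<in>{1..A}. q dvd a} = A div q"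
proof -
  have "{a\<in>{1..A}. q dvd a} = (\<lambda>k. k * q) ` {1..A div q}"
    using assms by (auto simp: image_iff less_eq_div_iff_mult_less_eq mult.commute elim!: dvdE)
  moreover have "inj_on (\<lambda>k. k * q) {1..A div q}" using assms by (auto simp: inj_on_def)
  ultimately show ?thesis by (simp add: card_image)
qed

text \<open>One half of Legendre's formula, with \<open>E\<close> arbitrary because it will come
  from values of a polynomial. Enlarging \<open>E\<close> to \<open>E'\<close>, beyond all
  multiplicities up to \<open>A\<close>, gives equality.\<close>

lemma multiplicity_fact_ge:
  assumes p: "Factorial_Ring.prime p"
  shows "(\<Sum>e=1..E. A div p ^ e) \<le> multiplicity p (fact A :: nat)"
proof -
  define E' where "E' = Max (insert E ((\<lambda>a. multiplicity p a) ` {1..A}))"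
  have "E \<le> E'" unfolding E'_def by (intro Max_ge) auto
  hence "(\<Sum>e=1..E. A div p ^ e) \<le> (\<Sum>e=1..E'. A div p ^ e)" by (intro sum_mono2) auto
  also have "\<dots> = (\<Sum>e=1..E'. card {a\<in>{1..A}. p ^ e dvd a})"
    using prime_gt_0_nat[OF p] by (intro sum.cong card_multiples[symmetric]) auto
  also have "\<dots> = multiplicity p (\<Prod>a=1..A. a)"
  proof (rule multiplicity_prod_eq_sum_card[OF p, symmetric])
    show "multiplicity p a \<le> E'" if "a \<in> {1..A}" for a
      unfolding E'_def using that by (intro Max_ge) auto
  qed auto
  also have "(\<Prod>a=1..A. a) = fact A" by (simp add: fact_prod)
  finally show ?thesis .
qed

text \<open>Primes of \<open>T\<close> not dividing \<open>n\<close> contribute the factor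
  \<open>1\<close>; this matters when \<open>n\<close> is a factorial and \<open>T\<close> comes
  from a product of polynomial values.\<close>

lemma prod_prime_power_multiplicity_le:
  fixes n :: nat
  assumes "n > 0" "finite T" "\<And>p. p \<in> T \<Longrightarrow> Factorial_Ring.prime p"
  shows "(\<Prod>p\<in>T. p ^ multiplicity p n) \<le> n"
proof -
  have "(\<Prod>p\<in>T. p ^ multiplicity p n) dvd (\<Prod>p\<in>T \<union> prime_factors n. p ^ multiplicity p n)"
    using assms(2) by (intro prod_dvd_prod_subset) auto
  also have "\<dots> = (\<Prod>p\<in>prime_factors n. p ^ multiplicity p n)"
    using assms by (intro prod.mono_neutral_right) (auto simp: in_prime_factors_iff not_dvd_imp_multiplicity_0)
  also have "\<dots> = n" using prime_factorization_nat[OF assms(1)] by simp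
  finally show ?thesis using assms(1) by (rule dvd_imp_le)
qed

context
  fixes m :: nat and \<zeta> :: complex
  assumes m_pos: "m > 0" and prim: "primitive_root_of_unity m \<zeta>"
begin

text \<open>The polynomial is the product of \<open>x - a\<close> over its complex zeros
  \<open>a\<close>, which are roots of unity, so each factor has modulus between
  \<open>x - 1\<close> and \<open>x + 1\<close>.\<close>

lemma
  fixes x :: nat
  assumes "x > 0"
  shows min_int_poly_root_of_unity_lower: "(real x - 1) ^ Polynomial.degree (min_int_poly \<zeta>) \<le> \<bar>real_of_int (poly (min_int_poly \<zeta>) (int x))\<bar>"
    and min_int_poly_root_of_unity_upper: "\<bar>real_of_int (poly (min_int_poly \<zeta>) (int x))\<bar> \<le> (real x + 1) ^ Polynomial.degree (min_int_poly \<zeta>)"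
proof -
  let ?f = "min_int_poly \<zeta>"
  define as where "as = complex_roots_int ?f"
  have F: "(\<Prod>a\<leftarrow>as. [:- a, 1:]) = of_int_poly ?f"
    using complex_roots_int(1)[of ?f] monic_min_int_poly_root_of_unity[OF m_pos prim] unfolding as_def by simp
  have len: "length as = Polynomial.degree ?f" unfolding as_def by (rule complex_roots_int(2))
  have eval: "poly (of_int_poly ?f) z = (\<Prod>a\<leftarrow>as. z - a)" for z :: complex
    unfolding F[symmetric] by (simp add: poly_prod_list o_def)
  have norm1: "cmod a = 1" if "a \<in> set as" for a
  proof -
    have "poly (of_int_poly ?f) a = 0" unfolding eval using that by (auto simp: prod_list_zero_iff)
    hence "a ^ m = 1" by (rule conjugate_power_m[OF m_pos prim])
    hence "cmod a ^ m = 1" by (metis norm_one norm_power)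
    thus ?thesis using m_pos by (metis norm_ge_zero power_eq_1_iff power_eq_iff_eq_base power_one zero_le_one)
  qed
  have val: "\<bar>real_of_int (poly ?f (int x))\<bar> = cmod (\<Prod>a\<leftarrow>as. of_nat x - a)"
  proof -
    have "complex_of_int (poly ?f (int x)) = (\<Prod>a\<leftarrow>as. of_nat x - a)"
      using eval[of "of_nat x"] of_int_hom.poly_map_poly[of ?f "int x"] by (metis of_int_of_nat_eq)
    thus ?thesis by (metis norm_of_int)
  qed
  have "(real x - 1) ^ length as \<le> cmod (\<Prod>a\<leftarrow>as. of_nat x - a) \<and>
      cmod (\<Prod>a\<leftarrow>as. of_nat x - a) \<le> (real x + 1) ^ length as"
    using norm1
  proof (induction as)
    case (Cons a as)
    have a: "cmod a = 1" using Cons.prems by simp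
    have lo: "real x - 1 \<le> cmod (of_nat x - a)" using norm_triangle_ineq2[of "of_nat x" a] a by simp
    have hi: "cmod (of_nat x - a) \<le> real x + 1" using norm_triangle_ineq4[of "of_nat x" a] a by simp
    \<comment> \<open>Lower bounds may be multiplied only if they are nonnegative, which is where
      \<open>x > 0\<close> enters.\<close>
    have x1: "real x - 1 \<ge> 0" using assms by simp
    have "0 \<le> (\<Prod>a\<leftarrow>as. cmod (of_nat x - a))" by (induction as) auto
    thus ?case using Cons lo hi x1 by (auto simp: norm_mult intro!: mult_mono)
  qed simp
  thus "(real x - 1) ^ Polynomial.degree ?f \<le> \<bar>real_of_int (poly ?f (int x))\<bar>"
    "\<bar>real_of_int (poly ?f (int x))\<bar> \<le> (real x + 1) ^ Polynomial.degree ?f"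
    unfolding val len by simp_all
qed

text \<open>Restricting the arguments of the polynomial to multiples of \<open>m\<close> keeps the prime factors of
  \<open>m\<close> out and gains the factor \<open>2^A\<close> over \<open>A!\<close>.\<close>

lemma exists_prime_dvd_min_int_poly:
  fixes S :: "nat set" and A k :: nat
  defines "D \<equiv> Polynomial.degree (min_int_poly \<zeta>)"
  assumes m3: "m \<ge> 3" and S: "finite S" "card S \<le> k"
    and A: "(m * A + 1) ^ (k * D) < 2 ^ A"
  obtains p a where "Factorial_Ring.prime p" "p \<notin> S" "\<not> p dvd m"
    "int p dvd poly (min_int_poly \<zeta>) (int (m * a))" "p \<le> (m * A + 1) ^ D"
proof -
  let ?f = "min_int_poly \<zeta>"
  define g where "g a = nat \<bar>poly ?f (int (m * a))\<bar>" for a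
  define M where "M = (m * A + 1) ^ D"
  define P where "P = (\<Prod>a=1..A. g a)"
  \<comment> \<open>Positivity of the degree permits extracting a \<open>D\<close>-th root at the
    end.\<close>
  have D0: "D > 0"
  proof (rule ccontr)
    assume "\<not> D > 0"
    hence "Polynomial.degree ?f = 0" by (simp add: D_def)
    then obtain c where c: "?f = [:c:]" by (metis degree_eq_zeroE)
    hence "c = 1" using monic_min_int_poly_root_of_unity[OF m_pos prim] by simp
    hence "is_unit ?f" unfolding c by simp
    thus False using irreducible_not_unit[OF irreducible_min_int_poly[OF unity_poly_root_witness[OF m_pos prim]]] by simp
  qed
  have lower: "(2 * a) ^ D \<le> g a" if "a \<in> {1..A}" for a
  proof -
    \<comment> \<open>Here \<open>m \<ge> 3\<close> and \<open>a \<ge> 1\<close> enter; this is the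
      source of the factor \<open>2 ^ A\<close>.\<close>
    have "real (2 * a) \<le> real (m * a) - 1"
    proof -
      have "3 * a \<le> m * a" using m3 by simp
      moreover have "a \<ge> 1" using that by simp
      ultimately have "2 * a + 1 \<le> m * a" by linarith
      thus ?thesis by linarith
    qed
    hence "real (2 * a) ^ D \<le> (real (m * a) - 1) ^ D" by (intro power_mono) auto
    also have "\<dots> \<le> \<bar>real_of_int (poly ?f (int (m * a)))\<bar>"
      unfolding D_def using m_pos that by (intro min_int_poly_root_of_unity_lower) auto
    also have "\<dots> = real (g a)" unfolding g_def by simp
    finally have "real ((2 * a) ^ D) \<le> real (g a)" by simp
    thus ?thesis by (simp only: of_nat_le_iff)
  qed
  have upper: "g a \<le> M" if "a \<in> {1..A}" for a
  proof -
    have "real (g a) = \<bar>real_of_int (poly ?f (int (m * a)))\<bar>" unfolding g_def by simp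
    also have "\<dots> \<le> (real (m * a) + 1) ^ D"
      unfolding D_def using m_pos that by (intro min_int_poly_root_of_unity_upper) auto
    also have "\<dots> \<le> (real (m * A) + 1) ^ D"
    proof (rule power_mono)
      have "m * a \<le> m * A" using that by simp
      thus "real (m * a) + 1 \<le> real (m * A) + 1" by (simp only: of_nat_le_iff add_le_cancel_right)
    qed simp
    also have "\<dots> = real M" unfolding M_def by (simp add: add.commute)
    finally show ?thesis by (simp only: of_nat_le_iff)
  qed
  have gpos: "g a > 0" if "a \<in> {1..A}" for a
  proof -
    have "(2 * a) ^ D > 0" using that by simp
    thus ?thesis using lower[OF that] by linarith
  qed
  have dvd_g: "p ^ e dvd g a \<longleftrightarrow> int p ^ e dvd poly ?f (int m * int a)" for p e a
    unfolding g_def by (simp add: int_dvd_int_iff[symmetric] del: int_dvd_int_iff)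
  have pm: "\<not> p dvd m" if "Factorial_Ring.prime p" "p dvd g a" for p a
  proof -
    have "int p dvd poly ?f (int m * int a)" using that(2) dvd_g[of p 1 a] by simp
    hence "\<not> int p dvd int m * int a"
      using that(1) by (intro dvd_poly_min_int_poly_imp_not_dvd[OF m_pos prim]) auto
    thus ?thesis by auto
  qed
  have P0: "P > 0" unfolding P_def using gpos by (intro prod_pos) auto
  have primes: "Factorial_Ring.prime p" if "p \<in> prime_factors P" for p using that by auto
  have dvdP: "\<exists>a\<in>{1..A}. p dvd g a" if "p \<in> prime_factors P" for p
  proof -
    have "p dvd (\<Prod>a=1..A. g a)" using that unfolding P_def by auto
    thus ?thesis using prime_dvd_prod_iff[OF _ primes[OF that], of "{1..A}" g] by auto
  qed
  \<comment> \<open>Summing \<open>D * (A div p ^ e + 1)\<close> over \<open>e\<close> up to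
    \<open>E\<close>, the quotients give at most \<open>D\<close> times the multiplicity of
    \<open>p\<close> in \<open>fact A\<close>, the ones give \<open>D * E\<close>; and
    \<open>p ^ E \<le> M\<close> because a single value \<open>g a\<close> attains the exponent
    \<open>E\<close>.\<close>
  have local: "p ^ multiplicity p P \<le> (p ^ multiplicity p (fact A :: nat)) ^ D * M ^ D"
    if p: "p \<in> prime_factors P" for p
  proof -
    note pr = primes[OF p]
    have pm': "\<not> p dvd m" using dvdP[OF p] pm[OF pr] by blast
    have ne: "{1..A} \<noteq> {}" using dvdP[OF p] by auto
    define E where "E = Max ((\<lambda>a. multiplicity p (g a)) ` {1..A})"
    have E: "multiplicity p (g a) \<le> E" if "a \<in> {1..A}" for a
      unfolding E_def using that by (intro Max_ge) auto
    have "E \<in> (\<lambda>a. multiplicity p (g a)) ` {1..A}" unfolding E_def using ne by (intro Max_in) auto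
    then obtain a where a: "a \<in> {1..A}" "E = multiplicity p (g a)" by auto
    have "p ^ E \<le> g a" unfolding a(2) using gpos[OF a(1)] by (intro dvd_imp_le multiplicity_dvd)
    hence pE: "p ^ E \<le> M" using upper[OF a(1)] by linarith
    have "multiplicity p P = (\<Sum>e=1..E. card {a\<in>{1..A}. p ^ e dvd g a})"
      unfolding P_def using gpos E by (intro multiplicity_prod_eq_sum_card[OF pr])
    also have "\<dots> \<le> (\<Sum>e=1..E. D * (A div p ^ e + 1))"
    proof (rule sum_mono)
      fix e assume "e \<in> {1..E}"
      thus "card {a\<in>{1..A}. p ^ e dvd g a} \<le> D * (A div p ^ e + 1)"
        unfolding dvd_g D_def by (intro card_roots_mod_prime_power_le[OF m_pos prim pr pm']) auto
    qed
    also have "\<dots> = D * (\<Sum>e=1..E. A div p ^ e) + D * E"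
      by (simp add: sum_distrib_left distrib_left sum.distrib mult.commute)
    also have "\<dots> \<le> D * multiplicity p (fact A :: nat) + D * E"
      using multiplicity_fact_ge[OF pr, of A E] by simp
    finally have "p ^ multiplicity p P \<le> p ^ (multiplicity p (fact A :: nat) * D + E * D)"
      using prime_gt_0_nat[OF pr] by (intro power_increasing) (auto simp: mult.commute)
    also have "\<dots> = (p ^ multiplicity p (fact A :: nat)) ^ D * (p ^ E) ^ D"
      by (simp add: power_add power_mult)
    also have "\<dots> \<le> (p ^ multiplicity p (fact A :: nat)) ^ D * M ^ D"
      using pE by (intro mult_left_mono power_mono) auto
    finally show ?thesis .
  qed
  have "\<exists>p\<in>prime_factors P. p \<notin> S"
  proof (rule ccontr)
    assume "\<not> ?thesis"
    hence sub: "prime_factors P \<subseteq> S" by blast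
    hence card: "card (prime_factors P) \<le> k" using S card_mono order_trans by blast
    have M1: "M \<ge> 1" unfolding M_def by simp
    \<comment> \<open>The lower and the upper estimate of \<open>P\<close> both contain
      \<open>fact A ^ D\<close>. Cancelling it and taking the \<open>D\<close>-th root leaves
      \<open>2 ^ A \<le> M ^ k\<close>, against the hypothesis on \<open>A\<close>.\<close>
    have "(2 ^ A * fact A :: nat) = (\<Prod>a=1..A. 2 * a)" by (simp add: prod.distrib fact_prod)
    hence "(2 ^ A * fact A) ^ D = (\<Prod>a=1..A. (2 * a) ^ D)" by (simp only: prod_power_distrib)
    also have "\<dots> \<le> P" unfolding P_def using lower by (intro prod_mono) auto
    also have "P = (\<Prod>p\<in>prime_factors P. p ^ multiplicity p P)" by (rule prime_factorization_nat[OF P0])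
    also have "\<dots> \<le> (\<Prod>p\<in>prime_factors P. (p ^ multiplicity p (fact A :: nat)) ^ D * M ^ D)"
      using local by (intro prod_mono) auto
    also have "\<dots> = (\<Prod>p\<in>prime_factors P. p ^ multiplicity p (fact A :: nat)) ^ D * (M ^ D) ^ card (prime_factors P)"
      by (simp add: prod.distrib prod_power_distrib)
    also have "\<dots> \<le> fact A ^ D * (M ^ D) ^ k"
      using M1 card primes
      by (intro mult_mono power_mono power_increasing prod_prime_power_multiplicity_le) auto
    finally have "(2 ^ A) ^ D * fact A ^ D \<le> fact A ^ D * (M ^ k) ^ D"
      by (simp add: power_mult_distrib power_mult[symmetric] mult.commute)
    hence "(2 ^ A) ^ D \<le> (M ^ k) ^ D" by (simp add: mult.commute)
    hence "2 ^ A \<le> M ^ k" using D0 by (simp add: power_mono_iff)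
    also have "\<dots> = (m * A + 1) ^ (k * D)" unfolding M_def by (simp only: power_mult[symmetric] mult.commute)
    finally show False using A by simp
  qed
  then obtain p where p: "p \<in> prime_factors P" "p \<notin> S" by blast
  obtain a where a: "a \<in> {1..A}" "p dvd g a" using dvdP[OF p(1)] by blast
  have "p \<le> g a" using a gpos by (intro dvd_imp_le)
  hence "p \<le> M" using upper[OF a(1)] by linarith
  moreover have "int p dvd poly ?f (int (m * a))" using a(2) dvd_g[of p 1 a] by simp
  ultimately show ?thesis using that[of p a] primes[OF p(1)] p(2) pm a(2) unfolding M_def by blast
qed

end

section \<open>The p-adic field\<close>

lemma real_null_comparison:
  fixes f g :: "nat \<Rightarrow> real"
  assumes "\<And>i. \<bar>f i\<bar> \<le> g i" "g \<longlonglongrightarrow> 0"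
  shows "f \<longlonglongrightarrow> 0"
proof (rule tendsto_0_le[OF assms(2), where K = 1])
  have "norm (f i) \<le> norm (g i) * 1" for i using assms(1)[of i] by simp
  thus "\<forall>\<^sub>F i in sequentially. norm (f i) \<le> norm (g i) * 1" by simp
qed

lemma padic_abs_rat_0 [simp]: "padic_abs_rat p 0 = 0"
  by (simp add: padic_abs_rat_def)

lemma padic_abs_rat_nonneg [simp]: "padic_abs_rat p x \<ge> 0"
  by (auto simp: padic_abs_rat_def split: prod.splits)

lemma rat_eq_int_divide:
  obtains a b where "x = (of_int a / of_int b :: rat)" "b \<noteq> 0"
  using quotient_of_div[of x] quotient_of_denom_pos[of x]
  by (metis less_irrefl prod.collapse)

lemma padic_Cauchy_const: "padic_Cauchy p (\<lambda>i. c)"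
  by (auto simp: padic_Cauchy_def)

lemma padic_null_iff: "x \<in> padic_null p \<longleftrightarrow> (\<lambda>i. padic_abs_rat p (x i)) \<longlonglongrightarrow> 0"
  by (simp add: padic_null_def)

definition padic_class :: "nat \<Rightarrow> (nat \<Rightarrow> rat) \<Rightarrow> (nat \<Rightarrow> rat) set" where
  "padic_class p x = padic_null p +>\<^bsub>padic_Cauchy_ring p\<^esub> x"

lemma padic_class_eq: "padic_class p x = (\<lambda>n i. n i + x i) ` padic_null p"
  unfolding padic_class_def a_r_coset_def r_coset_def by (auto simp: padic_Cauchy_ring_def)

context
  fixes p :: nat
  assumes prime_p: "Factorial_Ring.prime p"
begin

text \<open>The definition reads off the reduced fraction; comparing multiplicities in the
  cross-multiplied identity \<open>a * d = c * b\<close> extends it to arbitrary fractions.\<close>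

lemma padic_abs_rat_divide:
  assumes "a \<noteq> 0" "b \<noteq> 0"
  shows "padic_abs_rat p (of_int a / of_int b) =
    real p powi (int (multiplicity (int p) b) - int (multiplicity (int p) a))"
proof -
  obtain c d where q: "quotient_of (of_int a / of_int b) = (c, d)" by fastforce
  have d: "d > 0" using quotient_of_denom_pos[OF q] .
  have eq: "(of_int a / of_int b :: rat) = of_int c / of_int d" using quotient_of_div[OF q] .
  hence "(of_int (a * d) :: rat) = of_int (c * b)" using assms d by (simp add: field_simps)
  hence cross: "a * d = c * b" by (simp only: of_int_eq_iff)
  have c: "c \<noteq> 0" using cross assms d by auto
  have "prime_elem (int p)" using prime_p by simp
  note pm = prime_elem_multiplicity_mult_distrib[OF this]
  have "multiplicity (int p) a + multiplicity (int p) d = multiplicity (int p) c + multiplicity (int p) b"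
    using arg_cong[OF cross, of "multiplicity (int p)"] assms c d by (simp add: pm)
  hence "int (multiplicity (int p) d) - int (multiplicity (int p) c) =
      int (multiplicity (int p) b) - int (multiplicity (int p) a)" by linarith
  moreover have "(of_int a / of_int b :: rat) \<noteq> 0" using assms by simp
  ultimately show ?thesis unfolding padic_abs_rat_def q by (simp only: if_False prod.case)
qed

lemma padic_abs_rat_of_int:
  assumes "a \<noteq> 0"
  shows "padic_abs_rat p (of_int a) = real p powi (- int (multiplicity (int p) a))"
  using padic_abs_rat_divide[of a 1] assms by simp

lemma padic_abs_rat_1 [simp]: "padic_abs_rat p 1 = 1"
  using padic_abs_rat_of_int[of 1] by simp

lemma padic_abs_rat_mult: "padic_abs_rat p (x * y) = padic_abs_rat p x * padic_abs_rat p y"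
proof (cases "x = 0 \<or> y = 0")
  case False
  obtain a b where x: "x = of_int a / of_int b" "b \<noteq> 0" by (rule rat_eq_int_divide)
  obtain c d where y: "y = of_int c / of_int d" "d \<noteq> 0" by (rule rat_eq_int_divide)
  have nz: "a \<noteq> 0" "c \<noteq> 0" using False x y by auto
  have xy: "x * y = of_int (a * c) / of_int (b * d)" using x y by simp
  have pe: "prime_elem (int p)" using prime_p by simp
  have "int p \<noteq> 0" using prime_p by auto
  have p0: "real p \<noteq> 0" using prime_p by auto
  show ?thesis unfolding xy unfolding x y
    using nz x y p0
    by (simp only: padic_abs_rat_divide mult_eq_0_iff de_Morgan_disj simp_thms
        prime_elem_multiplicity_mult_distrib[OF pe])
       (simp add: power_int_add[symmetric] algebra_simps)
qed auto

lemma padic_abs_rat_minus [simp]: "padic_abs_rat p (- x) = padic_abs_rat p x"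
proof -
  have "padic_abs_rat p (-1) = 1" using padic_abs_rat_of_int[of "-1"] by simp
  thus ?thesis using padic_abs_rat_mult[of "-1" x] by simp
qed

lemma padic_abs_rat_diff_commute: "padic_abs_rat p (x - y) = padic_abs_rat p (y - x)"
  using padic_abs_rat_minus[of "x - y"] by simp

lemma padic_abs_rat_of_int_le:
  assumes "int p ^ k dvd a"
  shows "padic_abs_rat p (of_int a) \<le> (1 / real p) ^ k"
proof (cases "a = 0")
  case False
  have p1: "real p > 1" using prime_gt_1_nat[OF prime_p] by simp
  have "k \<le> multiplicity (int p) a"
    using assms False prime_p by (intro multiplicity_geI) auto
  hence "real p powi (- int (multiplicity (int p) a)) \<le> real p powi (- int k)"
    using p1 by (intro power_int_increasing) auto
  thus ?thesis using False
    by (simp add: padic_abs_rat_of_int power_int_minus power_one_over inverse_eq_divide)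
qed simp

lemma padic_abs_rat_of_int_le_1: "padic_abs_rat p (of_int a) \<le> 1"
  using padic_abs_rat_of_int_le[of 0 a] by simp

lemma padic_abs_rat_of_int_eq_1:
  assumes "\<not> int p dvd a"
  shows "padic_abs_rat p (of_int a) = 1"
  using assms by (cases "a = 0") (auto simp: padic_abs_rat_of_int not_dvd_imp_multiplicity_0)

lemma padic_abs_rat_add_le_max:
  "padic_abs_rat p (x + y) \<le> max (padic_abs_rat p x) (padic_abs_rat p y)"
proof -
  have ints: "padic_abs_rat p (of_int (a + c)) \<le> max (padic_abs_rat p (of_int a)) (padic_abs_rat p (of_int c))"
    for a c
  proof (cases "a = 0 \<or> c = 0 \<or> a + c = 0")
    case False
    have p1: "real p > 1" using prime_gt_1_nat[OF prime_p] by simp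
    define k where "k = min (multiplicity (int p) a) (multiplicity (int p) c)"
    have "int p ^ k dvd a + c" unfolding k_def
      by (intro dvd_add multiplicity_dvd') auto
    hence "padic_abs_rat p (of_int (a + c)) \<le> (1 / real p) ^ k"
      by (rule padic_abs_rat_of_int_le)
    also have "\<dots> = real p powi (- int k)"
      by (simp add: power_int_minus power_one_over inverse_eq_divide)
    also have "\<dots> \<le> max (padic_abs_rat p (of_int a)) (padic_abs_rat p (of_int c))"
      using False unfolding k_def by (auto simp: padic_abs_rat_of_int min_def)
    finally show ?thesis .
  qed (auto simp del: of_int_add simp: le_max_iff_disj)
  obtain a b where x: "x = of_int a / of_int b" "b \<noteq> 0" by (rule rat_eq_int_divide)
  obtain c d where y: "y = of_int c / of_int d" "d \<noteq> 0" by (rule rat_eq_int_divide)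
  let ?e = "1 / of_int (b * d) :: rat"
  have "x + y = of_int (a * d + c * b) * ?e" "x = of_int (a * d) * ?e" "y = of_int (c * b) * ?e"
    using x y by (simp_all add: field_simps)
  thus ?thesis using mult_right_mono[OF ints[of "a * d" "c * b"], of "padic_abs_rat p ?e"]
    by (simp only: padic_abs_rat_mult padic_abs_rat_nonneg max_mult_distrib_right if_True)
qed

lemma padic_abs_rat_triangle:
  "padic_abs_rat p (x + y) \<le> padic_abs_rat p x + padic_abs_rat p y"
  using padic_abs_rat_add_le_max[of x y] padic_abs_rat_nonneg[of p x] padic_abs_rat_nonneg[of p y] by linarith

text \<open>The dominant term decides: recovering \<open>x\<close> as \<open>(x + y) - y\<close>
  excludes a smaller value for the sum.\<close>

lemma padic_abs_rat_add_eq: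
  assumes "padic_abs_rat p y < padic_abs_rat p x"
  shows "padic_abs_rat p (x + y) = padic_abs_rat p x"
proof (rule antisym)
  show "padic_abs_rat p (x + y) \<le> padic_abs_rat p x"
    using padic_abs_rat_add_le_max[of x y] assms by simp
  show "padic_abs_rat p x \<le> padic_abs_rat p (x + y)"
    using padic_abs_rat_add_le_max[of "x + y" "- y"] assms by (simp add: max_def split: if_splits)
qed

section \<open>Cauchy sequences, null sequences and their quotient\<close>

lemma padic_Cauchy_bounded:
  assumes "padic_Cauchy p x"
  shows "\<exists>B>0. \<forall>i. padic_abs_rat p (x i) \<le> B"
proof -
  obtain N where N: "\<forall>i\<ge>N. \<forall>j\<ge>N. padic_abs_rat p (x i - x j) < 1"
    using assms[unfolded padic_Cauchy_def, rule_format, of 1] by auto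
  define B where "B = 1 + (\<Sum>i\<le>N. padic_abs_rat p (x i))"
  have le: "padic_abs_rat p (x i) \<le> B - 1" if "i \<le> N" for i
    unfolding B_def using that member_le_sum[of i "{..N}" "\<lambda>i. padic_abs_rat p (x i)"] by simp
  have "padic_abs_rat p (x i) \<le> B" for i
  proof (cases "i \<le> N")
    case False
    thus ?thesis using padic_abs_rat_triangle[of "x i - x N" "x N"] N[rule_format, of i N] le[of N] by simp
  qed (use le in force)
  moreover have "B > 0" unfolding B_def by (simp add: add_pos_nonneg sum_nonneg)
  ultimately show ?thesis by blast
qed

lemma padic_Cauchy_add:
  assumes "padic_Cauchy p x" "padic_Cauchy p y"
  shows "padic_Cauchy p (\<lambda>i. x i + y i)"
  unfolding padic_Cauchy_def
proof (intro allI impI)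
  fix e :: real assume "e > 0"
  hence e: "e / 2 > 0" by simp
  obtain M N where M: "\<And>i j. i \<ge> M \<Longrightarrow> j \<ge> M \<Longrightarrow> padic_abs_rat p (x i - x j) < e / 2"
    and N: "\<And>i j. i \<ge> N \<Longrightarrow> j \<ge> N \<Longrightarrow> padic_abs_rat p (y i - y j) < e / 2"
    using assms e unfolding padic_Cauchy_def by meson
  have "padic_abs_rat p (x i + y i - (x j + y j)) < e" if "i \<ge> max M N" "j \<ge> max M N" for i j
    using padic_abs_rat_triangle[of "x i - x j" "y i - y j"] M[of i j] N[of i j] that
    by (simp add: add_diff_add)
  thus "\<exists>N. \<forall>i\<ge>N. \<forall>j\<ge>N. padic_abs_rat p (x i + y i - (x j + y j)) < e" by blast
qed

lemma padic_Cauchy_mult: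
  assumes "padic_Cauchy p x" "padic_Cauchy p y"
  shows "padic_Cauchy p (\<lambda>i. x i * y i)"
  unfolding padic_Cauchy_def
proof (intro allI impI)
  fix e :: real assume e: "e > 0"
  obtain A where A: "A > 0" "\<And>i. padic_abs_rat p (x i) \<le> A" 
    using padic_Cauchy_bounded[OF assms(1)] by auto
  obtain B where B: "B > 0" "\<And>i. padic_abs_rat p (y i) \<le> B" 
    using padic_Cauchy_bounded[OF assms(2)] by auto
  have "e / (2 * B) > 0" "e / (2 * A) > 0" using e A B by simp_all
  then obtain M N where M: "\<And>i j. i \<ge> M \<Longrightarrow> j \<ge> M \<Longrightarrow> padic_abs_rat p (x i - x j) < e / (2 * B)"
    and N: "\<And>i j. i \<ge> N \<Longrightarrow> j \<ge> N \<Longrightarrow> padic_abs_rat p (y i - y j) < e / (2 * A)"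
    using assms unfolding padic_Cauchy_def by meson
  have "padic_abs_rat p (x i * y i - x j * y j) < e" if ij: "i \<ge> max M N" "j \<ge> max M N" for i j
  proof -
    have "x i * y i - x j * y j = x i * (y i - y j) + (x i - x j) * y j" by (simp add: algebra_simps)
    hence "padic_abs_rat p (x i * y i - x j * y j) \<le>
        padic_abs_rat p (x i) * padic_abs_rat p (y i - y j) + padic_abs_rat p (x i - x j) * padic_abs_rat p (y j)"
      using padic_abs_rat_triangle by (metis padic_abs_rat_mult)
    also have "\<dots> \<le> A * padic_abs_rat p (y i - y j) + padic_abs_rat p (x i - x j) * B"
      using A B by (intro add_mono mult_right_mono mult_left_mono) auto
    also have "\<dots> < A * (e / (2 * A)) + e / (2 * B) * B"
      using A B M N ij by (intro add_strict_mono mult_strict_left_mono mult_strict_right_mono) auto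
    also have "\<dots> = e" using A B by simp
    finally show ?thesis .
  qed
  thus "\<exists>N. \<forall>i\<ge>N. \<forall>j\<ge>N. padic_abs_rat p (x i * y i - x j * y j) < e" by blast
qed

lemma padic_Cauchy_poly:
  assumes "padic_Cauchy p x"
  shows "padic_Cauchy p (\<lambda>i. poly h (x i))"
  by (induction h) (auto intro!: padic_Cauchy_add padic_Cauchy_mult padic_Cauchy_const assms)

lemma padic_null_imp_Cauchy:
  assumes "x \<in> padic_null p"
  shows "padic_Cauchy p x"
  unfolding padic_Cauchy_def
proof (intro allI impI)
  fix e :: real assume "e > 0"
  then obtain N where N: "\<And>i. i \<ge> N \<Longrightarrow> padic_abs_rat p (x i) < e / 2"
    using assms unfolding padic_null_iff LIMSEQ_iff by (metis half_gt_zero padic_abs_rat_nonneg real_norm_def abs_of_nonneg diff_zero)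
  have "padic_abs_rat p (x i - x j) < e" if "i \<ge> N" "j \<ge> N" for i j
    using padic_abs_rat_triangle[of "x i" "- x j"] N[OF that(1)] N[OF that(2)] by simp
  thus "\<exists>N. \<forall>i\<ge>N. \<forall>j\<ge>N. padic_abs_rat p (x i - x j) < e" by blast
qed

lemma padic_null_add:
  assumes "x \<in> padic_null p" "y \<in> padic_null p"
  shows "(\<lambda>i. x i + y i) \<in> padic_null p"
proof -
  have "(\<lambda>i. padic_abs_rat p (x i) + padic_abs_rat p (y i)) \<longlonglongrightarrow> 0"
    using tendsto_add[of _ 0 _ _ 0] assms unfolding padic_null_iff by fastforce
  thus ?thesis unfolding padic_null_iff
    by (rule real_null_comparison[rotated]) (simp add: padic_abs_rat_triangle)
qed

lemma padic_null_mult: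
  assumes "x \<in> padic_null p" "padic_Cauchy p y"
  shows "(\<lambda>i. x i * y i) \<in> padic_null p"
proof -
  obtain B where B: "B > 0" "\<And>i. padic_abs_rat p (y i) \<le> B" 
    using padic_Cauchy_bounded[OF assms(2)] by auto
  have "(\<lambda>i. padic_abs_rat p (x i) * B) \<longlonglongrightarrow> 0"
    using tendsto_mult_left_zero assms(1) unfolding padic_null_iff by blast
  thus ?thesis unfolding padic_null_iff
    by (rule real_null_comparison[rotated]) (simp add: padic_abs_rat_mult mult_left_mono B)
qed

lemma cring_padic_Cauchy_ring: "cring (padic_Cauchy_ring p)"
proof (rule cringI)
  show "abelian_group (padic_Cauchy_ring p)"
  proof (rule abelian_groupI)
    fix x assume "x \<in> carrier (padic_Cauchy_ring p)"
    hence "padic_Cauchy p (\<lambda>i. - 1 * x i)"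
      by (intro padic_Cauchy_mult padic_Cauchy_const) (simp add: padic_Cauchy_ring_def)
    thus "\<exists>y\<in>carrier (padic_Cauchy_ring p). y \<oplus>\<^bsub>padic_Cauchy_ring p\<^esub> x = \<zero>\<^bsub>padic_Cauchy_ring p\<^esub>"
      by (intro bexI[of _ "\<lambda>i. - 1 * x i"]) (auto simp: padic_Cauchy_ring_def)
  qed (auto simp: padic_Cauchy_ring_def padic_Cauchy_add padic_Cauchy_const algebra_simps)
  show "comm_monoid (padic_Cauchy_ring p)"
    by (rule comm_monoidI)
      (auto simp: padic_Cauchy_ring_def padic_Cauchy_mult padic_Cauchy_const algebra_simps)
qed (auto simp: padic_Cauchy_ring_def algebra_simps)

lemma ideal_padic_null: "ideal (padic_null p) (padic_Cauchy_ring p)"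
proof (rule idealI)
  interpret cring "padic_Cauchy_ring p" by (rule cring_padic_Cauchy_ring)
  show "Ring.ring (padic_Cauchy_ring p)" by (rule ring_axioms)
  show "subgroup (padic_null p) (add_monoid (padic_Cauchy_ring p))"
  proof (rule add.subgroupI)
    show "padic_null p \<subseteq> carrier (padic_Cauchy_ring p)"
      by (auto simp: padic_Cauchy_ring_def padic_null_imp_Cauchy)
    show "padic_null p \<noteq> {}" using padic_null_iff[of "\<lambda>_. 0"] by auto
    fix x y assume x: "x \<in> padic_null p" and y: "y \<in> padic_null p"
    have xC: "x \<in> carrier (padic_Cauchy_ring p)"
      using padic_null_imp_Cauchy[OF x] by (simp add: padic_Cauchy_ring_def)
    have neg: "(\<lambda>i. x i * - 1) \<in> padic_null p" by (rule padic_null_mult[OF x padic_Cauchy_const])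
    have "\<ominus>\<^bsub>padic_Cauchy_ring p\<^esub> x = (\<lambda>i. x i * - 1)"
      using padic_null_imp_Cauchy[OF neg] xC
      by (intro minus_equality) (auto simp: padic_Cauchy_ring_def)
    thus "\<ominus>\<^bsub>padic_Cauchy_ring p\<^esub> x \<in> padic_null p" using neg by simp
    show "x \<oplus>\<^bsub>padic_Cauchy_ring p\<^esub> y \<in> padic_null p"
      using padic_null_add[OF x y] by (simp add: padic_Cauchy_ring_def)
  qed
next
  fix a x assume a: "a \<in> padic_null p" and x: "x \<in> carrier (padic_Cauchy_ring p)"
  have "(\<lambda>i. a i * x i) \<in> padic_null p"
    using padic_null_mult[OF a, of x] x by (simp add: padic_Cauchy_ring_def)
  thus "x \<otimes>\<^bsub>padic_Cauchy_ring p\<^esub> a \<in> padic_null p" "a \<otimes>\<^bsub>padic_Cauchy_ring p\<^esub> x \<in> padic_null p"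
    by (simp_all add: padic_Cauchy_ring_def mult.commute)
qed

lemma padic_class_ring_hom: "padic_class p \<in> Ring.ring_hom (padic_Cauchy_ring p) (padic_field p)"
  using ideal.rcos_ring_hom[OF ideal_padic_null] unfolding padic_class_def[abs_def] padic_field_def .

lemma padic_class_eqI:
  assumes "(\<lambda>i. x i - y i) \<in> padic_null p"
  shows "padic_class p x = padic_class p y"
proof -
  have *: "padic_class p x \<subseteq> padic_class p y" if d: "(\<lambda>i. x i - y i) \<in> padic_null p" for x y
  proof
    fix z assume "z \<in> padic_class p x"
    then obtain n where n: "n \<in> padic_null p" "z = (\<lambda>i. n i + x i)" unfolding padic_class_eq by auto
    have "z = (\<lambda>i. (n i + (x i - y i)) + y i)" unfolding n by auto
    thus "z \<in> padic_class p y" unfolding padic_class_eq using padic_null_add[OF n(1) d]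
      by (intro image_eqI)
  qed
  have "(\<lambda>i. y i - x i) \<in> padic_null p"
    using assms by (simp add: padic_null_iff padic_abs_rat_diff_commute)
  thus ?thesis using * assms by blast
qed

lemma padic_class_eqD:
  assumes "padic_class p x = padic_class p y"
  shows "(\<lambda>i. x i - y i) \<in> padic_null p"
proof -
  have "x \<in> padic_class p x" unfolding padic_class_eq
    by (rule image_eqI[of _ _ "\<lambda>_. 0"]) (auto simp: padic_null_iff)
  then obtain n where "n \<in> padic_null p" "x = (\<lambda>i. n i + y i)" using assms unfolding padic_class_eq by auto
  thus ?thesis by simp
qed

text \<open>Representatives of a class differ by a null sequence, so by the triangle inequality all
  share the limit \<open>r\<close>; as the class is nonempty, this determines the definite
  description in \<open>padic_abs\<close>.\<close>

lemma padic_abs_padic_class: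
  assumes "(\<lambda>i. padic_abs_rat p (x i)) \<longlonglongrightarrow> r"
  shows "padic_abs p (padic_class p x) = r"
proof -
  have lim: "(\<lambda>i. padic_abs_rat p (z i)) \<longlonglongrightarrow> r" if z: "z \<in> padic_class p x" for z
  proof -
    obtain n where n: "n \<in> padic_null p" "z = (\<lambda>i. n i + x i)" using z unfolding padic_class_eq by auto
    have "(\<lambda>i. padic_abs_rat p (z i) - padic_abs_rat p (x i)) \<longlonglongrightarrow> 0"
    proof (rule real_null_comparison[rotated])
      show "(\<lambda>i. padic_abs_rat p (n i)) \<longlonglongrightarrow> 0" using n by (simp add: padic_null_iff)
      show "\<bar>padic_abs_rat p (z i) - padic_abs_rat p (x i)\<bar> \<le> padic_abs_rat p (n i)" for i
        using padic_abs_rat_triangle[of "n i" "x i"] padic_abs_rat_triangle[of "- n i" "z i"] n by simp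
    qed
    from tendsto_add[OF this assms] show ?thesis by simp
  qed
  have "(\<lambda>i. 0 + x i) \<in> padic_class p x" unfolding padic_class_eq
    by (rule image_eqI[of _ _ "\<lambda>_. 0"]) (auto simp: padic_null_iff)
  thus ?thesis unfolding padic_abs_def
    using lim by (intro the_equality) (auto intro: LIMSEQ_unique)
qed

text \<open>The Newton polygon argument, for approximate zeros: with units at both ends, the
  constant term dominates if \<open>y\<close> has absolute value below \<open>1\<close>, the leading
  term if above, so the value of \<open>b\<close> would have absolute value at least
  \<open>1\<close>.\<close>

lemma padic_abs_rat_poly_lt_1_imp_eq_1:
  fixes b :: "int poly"
  assumes lc: "\<not> int p dvd Polynomial.lead_coeff b" and cc: "\<not> int p dvd poly.coeff b 0"
    and small: "padic_abs_rat p (poly (of_int_poly b) y) < 1"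
  shows "padic_abs_rat p y = 1"
proof (rule ccontr)
  assume ne: "padic_abs_rat p y \<noteq> 1"
  show False
  proof (cases "padic_abs_rat p y < 1")
    case True
    obtain c q where b: "b = pCons c q" by (cases b)
    have le1: "padic_abs_rat p (poly (of_int_poly q) y) \<le> 1" for q :: "int poly"
    proof (induction q)
      case (pCons a q)
      have "padic_abs_rat p (y * poly (of_int_poly q) y) \<le> 1"
        using pCons True by (simp add: padic_abs_rat_mult mult_le_one)
      thus ?case using pCons padic_abs_rat_add_le_max[of "of_int a" "y * poly (of_int_poly q) y"]
          padic_abs_rat_of_int_le_1[of a] by (simp add: of_int_hom.map_poly_pCons_hom)
    qed simp
    have "padic_abs_rat p (y * poly (of_int_poly q) y) < 1"
      using le1[of q] True mult_mono[of "padic_abs_rat p y" "padic_abs_rat p y" "padic_abs_rat p (poly (of_int_poly q) y)" 1]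
      by (simp add: padic_abs_rat_mult)
    moreover have "padic_abs_rat p (of_int c) = 1" using cc b by (intro padic_abs_rat_of_int_eq_1) simp
    ultimately have "padic_abs_rat p (of_int c + y * poly (of_int_poly q) y) = 1"
      by (subst padic_abs_rat_add_eq) auto
    thus False using small b by (simp add: of_int_hom.map_poly_pCons_hom)
  next
    case False
    hence big: "padic_abs_rat p y > 1" using ne by simp
    have "q \<noteq> 0 \<Longrightarrow> \<not> int p dvd Polynomial.lead_coeff q \<Longrightarrow>
      padic_abs_rat p (poly (of_int_poly q) y) = padic_abs_rat p y ^ Polynomial.degree q" for q :: "int poly"
    proof (induction q)
      case (pCons a q)
      show ?case
      proof (cases "q = 0")
        case True
        thus ?thesis using pCons by (simp add: of_int_hom.map_poly_pCons_hom padic_abs_rat_of_int_eq_1)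
      next
        case False
        hence IH: "padic_abs_rat p (y * poly (of_int_poly q) y) = padic_abs_rat p y ^ Suc (Polynomial.degree q)"
          using pCons by (simp add: padic_abs_rat_mult)
        have "1 < padic_abs_rat p y ^ Suc (Polynomial.degree q)" using big by (intro one_less_power) auto
        hence "padic_abs_rat p (y * poly (of_int_poly q) y + of_int a) = padic_abs_rat p y ^ Suc (Polynomial.degree q)"
          using IH padic_abs_rat_of_int_le_1[of a] by (subst padic_abs_rat_add_eq) auto
        thus ?thesis using False by (simp add: of_int_hom.map_poly_pCons_hom add.commute)
      qed
    qed simp
    from this[of b] lc have "padic_abs_rat p (poly (of_int_poly b) y) = padic_abs_rat p y ^ Polynomial.degree b"
      by fastforce
    thus False using small big one_le_power[of "padic_abs_rat p y" "Polynomial.degree b"] by linarith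
  qed
qed

end

section \<open>Embeddings of cyclotomic fields\<close>

context
  fixes m :: nat and \<zeta> :: complex and p r :: nat
  assumes m_pos: "m > 0" and prim: "primitive_root_of_unity m \<zeta>"
    and prime_p: "Factorial_Ring.prime p" and p_not_dvd_m: "\<not> p dvd m"
    and p_dvd: "int p dvd poly (min_int_poly \<zeta>) (int r)"
begin

definition Teichmueller_seq :: "nat \<Rightarrow> rat" where
  "Teichmueller_seq j = of_int (int r ^ (p ^ j))"

lemma padic_Cauchy_Teichmueller_seq: "padic_Cauchy p Teichmueller_seq"
  unfolding padic_Cauchy_def
proof (intro allI impI)
  fix e :: real assume "e > 0"
  moreover have p1: "1 / real p < 1" using prime_gt_1_nat[OF prime_p] by simp
  ultimately obtain N where N: "(1 / real p) ^ N < e" using real_arch_pow_inv by blast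
  \<comment> \<open>All terms are compared with the one of index \<open>N\<close>, to which the
    successive congruences telescope.\<close>
  have step: "int p ^ Suc N dvd int r ^ (p ^ i) - int r ^ (p ^ N)" if "i \<ge> N" for i
    using that
  proof (induction i rule: dec_induct)
    case (step i)
    have "int p ^ Suc N dvd int p ^ Suc i" using step by (intro le_imp_power_dvd) simp
    also have "\<dots> dvd int r ^ (p ^ Suc i) - int r ^ (p ^ i)"
      by (rule Teichmueller_Cauchy[OF m_pos prim prime_p p_not_dvd_m p_dvd])
    finally have "int p ^ Suc N dvd (int r ^ (p ^ Suc i) - int r ^ (p ^ i)) + (int r ^ (p ^ i) - int r ^ (p ^ N))"
      using step by (intro dvd_add)
    thus ?case by simp
  qed simp
  have "padic_abs_rat p (Teichmueller_seq i - Teichmueller_seq j) < e" if "i \<ge> N" "j \<ge> N" for i j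
  proof -
    have "int p ^ Suc N dvd (int r ^ (p ^ i) - int r ^ (p ^ N)) - (int r ^ (p ^ j) - int r ^ (p ^ N))"
      using step[OF that(1)] step[OF that(2)] by (rule dvd_diff)
    hence "int p ^ Suc N dvd int r ^ (p ^ i) - int r ^ (p ^ j)" by simp
    hence "padic_abs_rat p (of_int (int r ^ (p ^ i) - int r ^ (p ^ j))) \<le> (1 / real p) ^ Suc N"
      by (rule padic_abs_rat_of_int_le[OF prime_p])
    also have "\<dots> \<le> (1 / real p) ^ N" using p1 by (intro power_decreasing) auto
    finally show ?thesis using N by (simp add: Teichmueller_seq_def)
  qed
  thus "\<exists>N. \<forall>i\<ge>N. \<forall>j\<ge>N. padic_abs_rat p (Teichmueller_seq i - Teichmueller_seq j) < e" by blast
qed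

text \<open>Relations satisfied by \<open>\<zeta>\<close> persist in the limit: after clearing
  denominators they are multiples of the minimal polynomial, whose value at the \<open>j\<close>-th
  term is divisible by \<open>p ^ j\<close>.\<close>

lemma padic_null_poly_Teichmueller_seq:
  assumes "rat_eval \<zeta> h = 0"
  shows "(\<lambda>j. poly h (Teichmueller_seq j)) \<in> padic_null p"
proof -
  obtain N g where N: "N > 0" and g: "Polynomial.smult (of_int N) h = of_int_poly g"
    by (rule rat_poly_clear_denominators)
  have "poly (of_int_poly g) \<zeta> = 0"
    using arg_cong[OF g, of "rat_eval \<zeta>"] assms by (simp add: rat_eval_of_int_poly)
  hence "min_int_poly \<zeta> dvd g"
    using min_int_poly_dvd_iff[OF unity_poly_root_witness[OF m_pos prim], of g] by simp
  then obtain q where q: "g = min_int_poly \<zeta> * q" by auto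
  have bound: "padic_abs_rat p (poly (of_int_poly g) (Teichmueller_seq j)) \<le> (1 / real p) ^ j" for j
  proof -
    have "int p ^ j dvd int p ^ Suc j" by (intro le_imp_power_dvd) simp
    also have "\<dots> dvd poly (min_int_poly \<zeta>) (int r ^ (p ^ j))"
      by (rule Teichmueller_root[OF m_pos prim prime_p p_not_dvd_m p_dvd])
    also have "\<dots> dvd poly g (int r ^ (p ^ j))" unfolding q by simp
    finally have "padic_abs_rat p (of_int (poly g (int r ^ (p ^ j)))) \<le> (1 / real p) ^ j"
      by (rule padic_abs_rat_of_int_le[OF prime_p])
    thus ?thesis unfolding Teichmueller_seq_def by (simp only: of_int_hom.poly_map_poly)
  qed
  have "(\<lambda>j. padic_abs_rat p (poly (of_int_poly g) (Teichmueller_seq j))) \<longlonglongrightarrow> 0"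
  proof (rule real_null_comparison)
    show "(\<lambda>j. (1 / real p) ^ j) \<longlonglongrightarrow> 0"
      using prime_gt_1_nat[OF prime_p] by (intro LIMSEQ_power_zero) simp
    show "\<bar>padic_abs_rat p (poly (of_int_poly g) (Teichmueller_seq j))\<bar> \<le> (1 / real p) ^ j" for j
      using bound[of j] padic_abs_rat_nonneg by (simp only: abs_of_nonneg)
  qed
  hence "(\<lambda>j. poly (of_int_poly g) (Teichmueller_seq j)) \<in> padic_null p" by (simp add: padic_null_def)
  from padic_null_mult[OF prime_p this padic_Cauchy_const[of p "1 / of_int N"]]
  have "(\<lambda>j. poly (of_int_poly g) (Teichmueller_seq j) * (1 / of_int N)) \<in> padic_null p" .
  moreover have "poly (of_int_poly g) (Teichmueller_seq j) * (1 / of_int N) = poly h (Teichmueller_seq j)" for j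
    unfolding g[symmetric] using N by simp
  ultimately show ?thesis by simp
qed

text \<open>\<open>\<zeta>\<close> is sent to the class of the Teichmueller sequence. On the field
  generated by \<open>\<zeta>\<close> the choice of a representing polynomial is immaterial, since
  two of them differ by a relation of \<open>\<zeta>\<close>.\<close>

definition padic_embedding :: "complex \<Rightarrow> (nat \<Rightarrow> rat) set" where
  "padic_embedding z = padic_class p (\<lambda>j. poly (SOME h. rat_eval \<zeta> h = z) (Teichmueller_seq j))"

lemma padic_embedding_rat_eval:
  "padic_embedding (rat_eval \<zeta> h) = padic_class p (\<lambda>j. poly h (Teichmueller_seq j))"
proof -
  define h' where "h' = (SOME h'. rat_eval \<zeta> h' = rat_eval \<zeta> h)"
  have "rat_eval \<zeta> h' = rat_eval \<zeta> h" unfolding h'_def by (rule someI) (rule refl)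
  hence "rat_eval \<zeta> (h' - h) = 0" by simp
  hence "(\<lambda>j. poly (h' - h) (Teichmueller_seq j)) \<in> padic_null p" by (rule padic_null_poly_Teichmueller_seq)
  thus ?thesis unfolding padic_embedding_def h'_def[symmetric]
    by (intro padic_class_eqI[OF prime_p]) simp
qed

lemma rat_adjoin_cases:
  assumes "z \<in> carrier (rat_adjoin \<zeta>)"
  obtains h where "z = rat_eval \<zeta> h"
  using carrier_rat_adjoin_subset[OF unity_poly_root_witness[OF m_pos prim]] assms by auto

lemma poly_Teichmueller_seq_carrier: "(\<lambda>j. poly h (Teichmueller_seq j)) \<in> carrier (padic_Cauchy_ring p)"
  using padic_Cauchy_poly[OF prime_p padic_Cauchy_Teichmueller_seq, of h] by (simp add: padic_Cauchy_ring_def)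

lemma padic_embedding_ring_hom: "padic_embedding \<in> Ring.ring_hom (rat_adjoin \<zeta>) (padic_field p)"
proof (rule ring_hom_memI)
  note hom = padic_class_ring_hom[OF prime_p]
  show "padic_embedding z \<in> carrier (padic_field p)" if z: "z \<in> carrier (rat_adjoin \<zeta>)" for z
  proof -
    obtain h where "z = rat_eval \<zeta> h" using z by (rule rat_adjoin_cases)
    thus ?thesis using ring_hom_closed[OF hom poly_Teichmueller_seq_carrier[of h]]
      by (simp add: padic_embedding_rat_eval)
  qed
  fix y z assume "y \<in> carrier (rat_adjoin \<zeta>)" "z \<in> carrier (rat_adjoin \<zeta>)"
  then obtain g h where gh: "y = rat_eval \<zeta> g" "z = rat_eval \<zeta> h" by (metis rat_adjoin_cases)
  have "y \<otimes>\<^bsub>rat_adjoin \<zeta>\<^esub> z = rat_eval \<zeta> (g * h)"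
    using gh by (simp add: rat_adjoin_def ring_of_type_algebra_def)
  thus "padic_embedding (y \<otimes>\<^bsub>rat_adjoin \<zeta>\<^esub> z) = padic_embedding y \<otimes>\<^bsub>padic_field p\<^esub> padic_embedding z"
    using ring_hom_mult[OF hom poly_Teichmueller_seq_carrier[of g] poly_Teichmueller_seq_carrier[of h]] gh
    by (simp only: padic_embedding_rat_eval) (simp add: padic_Cauchy_ring_def)
  have "y \<oplus>\<^bsub>rat_adjoin \<zeta>\<^esub> z = rat_eval \<zeta> (g + h)"
    using gh by (simp add: rat_adjoin_def ring_of_type_algebra_def)
  thus "padic_embedding (y \<oplus>\<^bsub>rat_adjoin \<zeta>\<^esub> z) = padic_embedding y \<oplus>\<^bsub>padic_field p\<^esub> padic_embedding z"
    using ring_hom_add[OF hom poly_Teichmueller_seq_carrier[of g] poly_Teichmueller_seq_carrier[of h]] gh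
    by (simp only: padic_embedding_rat_eval) (simp add: padic_Cauchy_ring_def)
next
  have "\<one>\<^bsub>rat_adjoin \<zeta>\<^esub> = rat_eval \<zeta> 1" by (simp add: rat_adjoin_def ring_of_type_algebra_def)
  thus "padic_embedding \<one>\<^bsub>rat_adjoin \<zeta>\<^esub> = \<one>\<^bsub>padic_field p\<^esub>"
    using ring_hom_one[OF padic_class_ring_hom[OF prime_p]]
    by (simp only: padic_embedding_rat_eval) (simp add: padic_Cauchy_ring_def)
qed

text \<open>If a nonzero difference had image zero, multiplying by its inverse, again a polynomial
  in \<open>\<zeta>\<close>, would put the constant sequence \<open>1\<close> among the null
  sequences.\<close>

lemma inj_on_padic_embedding: "inj_on padic_embedding (carrier (rat_adjoin \<zeta>))"
proof (rule inj_onI)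
  fix y z assume "y \<in> carrier (rat_adjoin \<zeta>)" "z \<in> carrier (rat_adjoin \<zeta>)"
    and eq: "padic_embedding y = padic_embedding z"
  then obtain g h where gh: "y = rat_eval \<zeta> g" "z = rat_eval \<zeta> h" by (metis rat_adjoin_cases)
  have "(\<lambda>j. poly g (Teichmueller_seq j) - poly h (Teichmueller_seq j)) \<in> padic_null p"
    using eq unfolding gh padic_embedding_rat_eval by (rule padic_class_eqD[OF prime_p])
  hence null: "(\<lambda>j. poly (g - h) (Teichmueller_seq j)) \<in> padic_null p" by simp
  show "y = z"
  proof (rule ccontr)
    assume "y \<noteq> z"
    hence nz: "rat_eval \<zeta> (g - h) \<noteq> 0" using gh by simp
    then obtain k where k: "rat_eval \<zeta> k = inverse (rat_eval \<zeta> (g - h))"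
      using rat_eval_inverse[OF unity_poly_root_witness[OF m_pos prim]] by blast
    have "rat_eval \<zeta> (1 - (g - h) * k) = 0" using nz k by (simp del: rat_eval_simps(3) add: rat_eval_simps(3)[of \<zeta> 1])
    hence "(\<lambda>j. poly (1 - (g - h) * k) (Teichmueller_seq j)) \<in> padic_null p" by (rule padic_null_poly_Teichmueller_seq)
    from padic_null_add[OF prime_p this
        padic_null_mult[OF prime_p null padic_Cauchy_poly[OF prime_p padic_Cauchy_Teichmueller_seq, of k]]]
    have "(\<lambda>j. 1) \<in> padic_null p" by simp
    hence "(\<lambda>j. 1 :: real) \<longlonglongrightarrow> 0" by (simp add: padic_null_def prime_p)
    thus False by (simp add: LIMSEQ_const_iff)
  qed
qed

text \<open>Along the approximations of \<open>\<beta>\<close> the values of its minimal polynomial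
  tend to \<open>0\<close>. Once their absolute values are below \<open>1\<close>, the
  approximations have absolute value exactly \<open>1\<close>, so the limit is attained.\<close>

lemma padic_abs_padic_embedding_eq_1:
  assumes \<beta>: "\<beta> \<in> carrier (rat_adjoin \<zeta>)" and
    lc: "\<not> int p dvd Polynomial.lead_coeff (min_int_poly \<beta>)" and
    cc: "\<not> int p dvd poly.coeff (min_int_poly \<beta>) 0"
  shows "padic_abs p (padic_embedding \<beta>) = 1"
proof -
  obtain h where h: "\<beta> = rat_eval \<zeta> h" using \<beta> by (rule rat_adjoin_cases)
  obtain b where b: "b \<noteq> 0" "poly (of_int_poly b) \<beta> = 0"
    using rat_eval_algebraic[OF unity_poly_root_witness[OF m_pos prim]] unfolding h by metis
  have "poly (of_int_poly (min_int_poly \<beta>)) \<beta> = 0"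
    using min_int_poly_dvd_iff[OF b, of "min_int_poly \<beta>"] by simp
  hence "rat_eval \<zeta> (of_int_poly (min_int_poly \<beta>) \<circ>\<^sub>p h) = 0" by (simp add: rat_eval_pcompose h)
  from padic_null_poly_Teichmueller_seq[OF this]
  have "(\<lambda>j. padic_abs_rat p (poly (of_int_poly (min_int_poly \<beta>)) (poly h (Teichmueller_seq j)))) \<longlonglongrightarrow> 0"
    by (simp add: padic_null_def poly_pcompose)
  hence "\<forall>\<^sub>F j in sequentially. padic_abs_rat p (poly (of_int_poly (min_int_poly \<beta>)) (poly h (Teichmueller_seq j))) < 1"
    by (rule order_tendstoD) simp
  hence "\<forall>\<^sub>F j in sequentially. padic_abs_rat p (poly h (Teichmueller_seq j)) = 1"
    by eventually_elim (rule padic_abs_rat_poly_lt_1_imp_eq_1[OF prime_p lc cc])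
  hence "(\<lambda>j. padic_abs_rat p (poly h (Teichmueller_seq j))) \<longlonglongrightarrow> 1" by (rule tendsto_eventually)
  thus ?thesis unfolding h padic_embedding_rat_eval by (rule padic_abs_padic_class[OF prime_p])
qed

end

section \<open>Bad primes and the bound\<close>

text \<open>Prime by prime: odd primes satisfy \<open>p \<le> (p - 1) ^ 2\<close>, and only
  \<open>p = 2\<close> costs a factor \<open>2\<close>. This eliminates \<open>m\<close> from the
  final bound in favour of \<open>totient m\<close>.\<close>

lemma le_twice_totient_squared:
  fixes m :: nat
  assumes "m > 0"
  shows "m \<le> 2 * totient m ^ 2"
proof -
  let ?t = "\<lambda>p. p ^ (multiplicity p m - 1) * (p - 1)"
  have local: "p ^ multiplicity p m \<le> (if p = 2 then 2 else 1) * ?t p ^ 2" if p: "p \<in> prime_factors m" for p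
  proof -
    have pr: "Factorial_Ring.prime p" using p by auto
    have "multiplicity p m > 0" using p by (simp add: prime_factors_multiplicity)
    then obtain k where k: "multiplicity p m = Suc k" using gr0_conv_Suc by blast
    have "p \<le> (if p = 2 then 2 else 1) * (p - 1) ^ 2"
    proof (cases "p = 2")
      case False
      hence "p \<ge> 3" using prime_ge_2_nat[OF pr] by simp
      then obtain q where q: "p = q + 3" by (metis add.commute le_Suc_ex)
      show ?thesis using q by (simp add: power2_eq_square algebra_simps)
    qed simp
    hence "p ^ k * p \<le> (p ^ k) ^ 2 * ((if p = 2 then 2 else 1) * (p - 1) ^ 2)"
      using prime_gt_0_nat[OF pr] by (intro mult_mono) (auto simp: self_le_power)
    thus ?thesis unfolding k by (simp add: power_mult_distrib ac_simps split: if_splits)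
  qed
  have "m = (\<Prod>p\<in>prime_factors m. p ^ multiplicity p m)" by (rule prime_factorization_nat[OF assms])
  also have "\<dots> \<le> (\<Prod>p\<in>prime_factors m. (if p = 2 then 2 else 1) * ?t p ^ 2)"
    using local by (intro prod_mono) auto
  also have "\<dots> = (\<Prod>p\<in>prime_factors m. if p = 2 then 2 else 1) * totient m ^ 2"
    unfolding totient_formula1[OF assms] prod_power_distrib by (rule prod.distrib)
  also have "(\<Prod>p\<in>prime_factors m. if p = 2 then 2 else 1 :: nat) \<le> 2"
    by (simp add: prod.delta)
  finally show ?thesis by simp
qed

text \<open>Consequently the factor \<open>delta m\<close> can only enlarge the exponent of the
  final bound.\<close>

lemma delta_ge_1:
  assumes "m > 0"
  shows "delta m \<ge> 1"
proof -
  define l where "l = Max (prime_factors m)"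
  have "m div l ^ multiplicity l m > 0"
    using assms dvd_div_eq_0_iff[OF multiplicity_dvd[of l m]] by simp
  thus ?thesis unfolding delta_def l_def[symmetric] by (simp add: Let_def Suc_le_eq)
qed

lemma two_power_card_prime_factors_le:
  assumes "(n::nat) > 0"
  shows "2 ^ card (prime_factors n) \<le> n"
proof -
  have "2 ^ card (prime_factors n) = (\<Prod>p\<in>prime_factors n. 2::nat)" by simp
  also have "\<dots> \<le> (\<Prod>p\<in>prime_factors n. p ^ multiplicity p n)"
  proof (rule prod_mono)
    fix p assume p: "p \<in> prime_factors n"
    have "2 \<le> p" using p by (auto intro: prime_ge_2_nat)
    also have "p \<le> p ^ multiplicity p n"
      using p \<open>2 \<le> p\<close> by (intro self_le_power) (auto simp: prime_factors_multiplicity)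
    finally show "0 \<le> (2::nat) \<and> 2 \<le> p ^ multiplicity p n" by simp
  qed
  also have "\<dots> = n" using prime_factorization_nat[OF assms] by simp
  finally show ?thesis .
qed

text \<open>Up to sign the constant coefficient is the leading one times the product of the zeros,
  and \<open>max 1 (cmod a)\<close> dominates both \<open>1\<close> and the modulus of the zero
  \<open>a\<close>.\<close>

lemma
  shows abs_lead_coeff_le_mahler_measure: "\<bar>real_of_int (Polynomial.lead_coeff b)\<bar> \<le> mahler_measure b"
    and abs_coeff_0_le_mahler_measure: "\<bar>real_of_int (poly.coeff b 0)\<bar> \<le> mahler_measure b"
proof -
  define as where "as = complex_roots_complex (of_int_poly b)"
  have M: "mahler_measure b = \<bar>real_of_int (Polynomial.lead_coeff b)\<bar> * (\<Prod>a\<leftarrow>as. max 1 (cmod a))"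
    unfolding mahler_measure_def mahler_measure_poly_def as_def by simp
  have "(\<Prod>a\<leftarrow>as. max 1 (cmod a)) \<ge> 1" 
    using mahler_measure_monic_ge_1 unfolding mahler_measure_monic_def as_def .
  thus "\<bar>real_of_int (Polynomial.lead_coeff b)\<bar> \<le> mahler_measure b"
    unfolding M by (metis abs_ge_zero mult.right_neutral mult_left_mono)
  have "of_int_poly b = Polynomial.smult (of_int (Polynomial.lead_coeff b)) (\<Prod>a\<leftarrow>as. [:- a, 1:])"
    unfolding as_def using complex_roots(1)[of "of_int_poly b"] by simp
  hence "poly (of_int_poly b) 0 = of_int (Polynomial.lead_coeff b) * (\<Prod>a\<leftarrow>as. - a)"
    by (simp add: poly_prod_list o_def)
  hence "complex_of_int (poly.coeff b 0) = of_int (Polynomial.lead_coeff b) * (\<Prod>a\<leftarrow>as. - a)"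
    by (simp add: poly_0_coeff_0)
  hence "\<bar>real_of_int (poly.coeff b 0)\<bar> = \<bar>real_of_int (Polynomial.lead_coeff b)\<bar> * cmod (\<Prod>a\<leftarrow>as. - a)"
    by (metis norm_mult norm_of_int)
  also have "cmod (\<Prod>a\<leftarrow>as. - a) \<le> (\<Prod>a\<leftarrow>as. max 1 (cmod a))"
  proof (induction as)
    case (Cons a as)
    have "0 \<le> (\<Prod>a\<leftarrow>as. cmod (- a))" by (induction as) auto
    thus ?case using Cons by (auto simp: norm_mult intro!: mult_mono)
  qed simp
  finally show "\<bar>real_of_int (poly.coeff b 0)\<bar> \<le> mahler_measure b"
    unfolding M by (simp add: mult_left_mono)
qed

text \<open>Outside this set both end coefficients are \<open>p\<close>-adic units, as the unit
  criterion for embeddings requires. For nonzero algebraic \<open>\<beta>\<close> their product is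
  nonzero, so \<open>prime_factors\<close> lists all its prime divisors.\<close>

definition bad_primes :: "complex \<Rightarrow> nat set" where
  "bad_primes \<beta> =
     prime_factors (nat \<bar>Polynomial.lead_coeff (min_int_poly \<beta>) * poly.coeff (min_int_poly \<beta>) 0\<bar>)"

text \<open>Distinct primes contribute at least \<open>2\<close> each, so
  \<open>2 ^ card (bad_primes \<beta>)\<close> is at most the product of the two end coefficients in
  absolute value, hence at most the square of the Mahler measure, whose logarithm is degree times
  height.\<close>

lemma
  assumes b: "b \<noteq> 0" "poly (of_int_poly b) \<beta> = 0" and \<beta>: "\<beta> \<noteq> (0::complex)"
    and D: "Polynomial.degree (min_int_poly \<beta>) \<le> D"
  shows card_bad_primes_le: "real (card (bad_primes \<beta>)) \<le> 4 * real D * weil_height \<beta>"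
    and weil_height_nonneg: "weil_height \<beta> \<ge> 0"
    and not_in_bad_primes: "Factorial_Ring.prime p \<Longrightarrow> p \<notin> bad_primes \<beta> \<Longrightarrow>
      \<not> int p dvd Polynomial.lead_coeff (min_int_poly \<beta>) \<and> \<not> int p dvd poly.coeff (min_int_poly \<beta>) 0"
proof -
  let ?f = "min_int_poly \<beta>"
  define n where "n = nat \<bar>Polynomial.lead_coeff ?f * poly.coeff ?f 0\<bar>"
  note irr = irreducible_min_int_poly[OF b]
  have f0: "?f \<noteq> 0" using irr by auto
  have c0: "poly.coeff ?f 0 \<noteq> 0" by (rule coeff_0_min_int_poly_ne_0[OF b \<beta>])
  have n0: "n > 0" unfolding n_def using f0 c0 by simp
  \<comment> \<open>The degree is the denominator in \<open>weil_height\<close>, so it must be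
    positive for the Mahler measure to be recovered from the height.\<close>
  have deg: "Polynomial.degree ?f > 0"
  proof (rule ccontr)
    assume "\<not> ?thesis"
    then obtain c where c: "?f = [:c:]" by (metis degree_eq_zeroE not_gr_zero)
    have "poly (of_int_poly ?f) \<beta> = 0" using min_int_poly_dvd_iff[OF b, of ?f] by simp
    hence "c = 0" unfolding c by (simp add: of_int_hom.map_poly_pCons_hom)
    thus False using f0 c by simp
  qed
  have M1: "mahler_measure ?f \<ge> 1" using mahler_measure_poly_ge_1[OF f0] .
  have ln_M: "ln (mahler_measure ?f) = real (Polynomial.degree ?f) * weil_height \<beta>"
    unfolding weil_height_def using deg by simp
  show h0: "weil_height \<beta> \<ge> 0" unfolding weil_height_def using M1 by simp
  have "real n = \<bar>real_of_int (Polynomial.lead_coeff ?f)\<bar> * \<bar>real_of_int (poly.coeff ?f 0)\<bar>"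
    unfolding n_def by (simp add: abs_mult)
  also have "\<dots> \<le> mahler_measure ?f * mahler_measure ?f"
    using M1 by (intro mult_mono abs_lead_coeff_le_mahler_measure abs_coeff_0_le_mahler_measure) auto
  finally have nM: "real n \<le> mahler_measure ?f * mahler_measure ?f" .
  have "2 ^ card (bad_primes \<beta>) \<le> n"
    unfolding bad_primes_def n_def[symmetric] by (rule two_power_card_prime_factors_le[OF n0])
  hence "real (2 ^ card (bad_primes \<beta>)) \<le> real n" by (simp only: of_nat_le_iff)
  hence "real (2 ^ card (bad_primes \<beta>)) \<le> mahler_measure ?f * mahler_measure ?f"
    using nM by (rule order_trans)
  hence "2 ^ card (bad_primes \<beta>) \<le> mahler_measure ?f * mahler_measure ?f" by simp
  hence "ln (2 ^ card (bad_primes \<beta>)) \<le> ln (mahler_measure ?f * mahler_measure ?f)"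
    using M1 by (subst ln_le_cancel_iff) auto
  hence "real (card (bad_primes \<beta>)) * ln 2 \<le> 2 * ln (mahler_measure ?f)"
    using M1 by (simp add: ln_realpow ln_mult)
  \<comment> \<open>\<open>ln 2 \<ge> 1 / 2\<close> comes from
    \<open>ln (1 / 2) \<le> - 1 / 2\<close>; with the squared Mahler measure it produces the
    constant \<open>4\<close>.\<close>
  moreover have "real (card (bad_primes \<beta>)) * (1 / 2) \<le> real (card (bad_primes \<beta>)) * ln 2"
    using ln_le_minus_one[of "1 / 2 :: real"] by (intro mult_left_mono) (auto simp: ln_div)
  ultimately have "real (card (bad_primes \<beta>)) \<le> 4 * (real (Polynomial.degree ?f) * weil_height \<beta>)"
    unfolding ln_M by simp
  also have "\<dots> \<le> 4 * (real D * weil_height \<beta>)"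
    using D h0 by (intro mult_left_mono mult_right_mono) auto
  finally show "real (card (bad_primes \<beta>)) \<le> 4 * real D * weil_height \<beta>" by simp
  show "\<not> int p dvd Polynomial.lead_coeff ?f \<and> \<not> int p dvd poly.coeff ?f 0"
    if p: "Factorial_Ring.prime p" "p \<notin> bad_primes \<beta>"
  proof -
    have "\<not> p dvd n" using p n0 unfolding bad_primes_def n_def[symmetric] by (auto simp: in_prime_factors_iff)
    hence "\<not> int p dvd int n" by simp
    hence "\<not> int p dvd Polynomial.lead_coeff ?f * poly.coeff ?f 0" unfolding n_def by simp
    thus ?thesis by auto
  qed
qed

section \<open>Choice of the parameters and the final bound\<close>

text \<open>The search range \<open>A = N ^ 20\<close> is generous: the base is at most
  \<open>N ^ 24\<close>, the exponent at most \<open>4 * N ^ 2\<close>, and \<open>N < 2 ^ N\<close>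
  turns the power into \<open>2 ^ (96 * N ^ 3)\<close>, where
  \<open>96 < 2 ^ 17 \<le> N ^ 17\<close>.\<close>

lemma twentieth_power_suffices:
  fixes N m k D :: nat
  assumes N: "N \<ge> 2" and m: "m \<le> 2 * N ^ 2" and k: "k \<le> 4 * N" and D: "D \<le> N"
  shows "m * N ^ 20 + 1 \<le> N ^ 24" "(m * N ^ 20 + 1) ^ (k * D) < 2 ^ (N ^ 20)"
proof -
  have N22: "N ^ 22 \<ge> 1" using N by simp
  have "m * N ^ 20 + 1 \<le> 2 * N ^ 2 * N ^ 20 + 1" using m by simp
  also have "\<dots> = 2 * N ^ 22 + 1" by (simp flip: power_add)
  also have "\<dots> \<le> 4 * N ^ 22" using N22 by linarith
  also have "\<dots> \<le> N ^ 2 * N ^ 22" using power_mono[OF N, of 2] by (intro mult_right_mono) auto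
  also have "\<dots> = N ^ 24" by (simp flip: power_add)
  finally show le: "m * N ^ 20 + 1 \<le> N ^ 24" .
  have "k * D \<le> 4 * N * N" using k D by (intro mult_le_mono)
  hence kD: "k * D \<le> 4 * N ^ 2" by (simp add: power2_eq_square)
  have "(m * N ^ 20 + 1) ^ (k * D) \<le> (N ^ 24) ^ (k * D)" using le by (intro power_mono) auto
  also have "\<dots> \<le> (N ^ 24) ^ (4 * N ^ 2)" using kD N by (intro power_increasing) auto
  also have "\<dots> \<le> ((2 ^ N) ^ 24) ^ (4 * N ^ 2)"
    by (intro power_mono) (auto intro: less_imp_le)
  also have "\<dots> = 2 ^ (96 * N ^ 3)"
    by (simp flip: power_mult add: power3_eq_cube power2_eq_square ac_simps)
  also have "\<dots> < 2 ^ (N ^ 20)"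
  proof (rule power_strict_increasing)
    have "96 * N ^ 3 < 2 ^ 17 * N ^ 3" using N by simp
    also have "\<dots> \<le> N ^ 17 * N ^ 3" using N by (intro mult_right_mono power_mono) auto
    also have "\<dots> = N ^ 20" by (simp flip: power_add)
    finally show "96 * N ^ 3 < N ^ 20" .
  qed simp
  finally show "(m * N ^ 20 + 1) ^ (k * D) < 2 ^ (N ^ 20)" .
qed

text \<open>The prime is sought outside the bad primes of all \<open>\<beta> i\<close> at once; the
  Teichmueller embedding at that prime then makes every \<open>\<beta> i\<close> a unit.\<close>

lemma exists_padic_embedding:
  fixes m n :: nat and \<zeta> :: complex and \<beta> :: "nat \<Rightarrow> complex"
  defines "B \<equiv> real (totient m) * (\<Sum>i=1..n. weil_height (\<beta> i)) + real (totient m) * real n"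
  assumes m: "m > 2" and prim: "primitive_root_of_unity m \<zeta>" and n: "n \<ge> 1"
    and \<beta>: "\<And>i. i \<in> {1..n} \<Longrightarrow> \<beta> i \<in> carrier (rat_adjoin \<zeta>) \<and> \<beta> i \<noteq> 0"
  shows "\<exists>p. Factorial_Ring.prime p \<and> real p \<le> B powr (48 * real (totient m) * real (delta m)) \<and>
    (\<exists>\<sigma>. \<sigma> \<in> Ring.ring_hom (rat_adjoin \<zeta>) (padic_field p) \<and>
      inj_on \<sigma> (carrier (rat_adjoin \<zeta>)) \<and> (\<forall>i\<in>{1..n}. padic_abs p (\<sigma> (\<beta> i)) = 1))"
proof -
  have m0: "m > 0" using m by simp
  note root = unity_poly_root_witness[OF m0 prim]
  define d where "d = totient m"
  define D where "D = Polynomial.degree (min_int_poly \<zeta>)"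
  have Dd: "D \<le> d" unfolding D_def d_def by (rule degree_min_int_poly_root_of_unity_le[OF m0 prim])
  have d2: "d \<ge> 2" using totient_gt_1[OF m] by (simp add: d_def)
  have f0: "min_int_poly \<zeta> \<noteq> 0" using irreducible_min_int_poly[OF root] by auto
  have f_root: "poly (of_int_poly (min_int_poly \<zeta>)) \<zeta> = 0"
    using min_int_poly_dvd_iff[OF root, of "min_int_poly \<zeta>"] by simp
  have alg: "\<exists>b. b \<noteq> 0 \<and> poly (of_int_poly b) (\<beta> i) = 0" and
    deg: "Polynomial.degree (min_int_poly (\<beta> i)) \<le> d" if i: "i \<in> {1..n}" for i
  proof -
    obtain h where h: "\<beta> i = rat_eval \<zeta> h"
      using carrier_rat_adjoin_subset[OF f0 f_root] \<beta>[OF i] by auto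
    show "\<exists>b. b \<noteq> 0 \<and> poly (of_int_poly b) (\<beta> i) = 0"
      unfolding h using rat_eval_algebraic[OF f0 f_root, of h] by metis
    show "Polynomial.degree (min_int_poly (\<beta> i)) \<le> d"
      unfolding h using degree_min_int_poly_rat_eval_le[OF f0 f_root, of h] Dd by (simp add: D_def)
  qed
  define H where "H = (\<Sum>i=1..n. weil_height (\<beta> i))"
  define Bv where "Bv = real d * H + real d * real n"
  have H0: "H \<ge> 0" unfolding H_def
  proof (rule sum_nonneg)
    fix i assume i: "i \<in> {1..n}"
    show "weil_height (\<beta> i) \<ge> 0" using alg[OF i] weil_height_nonneg[OF _ _ _ deg[OF i]] \<beta>[OF i] by blast
  qed
  define S where "S = (\<Union>i\<in>{1..n}. bad_primes (\<beta> i))"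
  have finS: "finite S" unfolding S_def bad_primes_def by simp
  have "real (card S) \<le> real (\<Sum>i=1..n. card (bad_primes (\<beta> i)))"
    unfolding S_def by (intro of_nat_mono card_UN_le) simp
  also have "\<dots> = (\<Sum>i=1..n. real (card (bad_primes (\<beta> i))))" by simp
  also have "\<dots> \<le> (\<Sum>i=1..n. 4 * real d * weil_height (\<beta> i))"
  proof (rule sum_mono)
    fix i assume i: "i \<in> {1..n}"
    show "real (card (bad_primes (\<beta> i))) \<le> 4 * real d * weil_height (\<beta> i)"
      using alg[OF i] card_bad_primes_le[OF _ _ _ deg[OF i]] \<beta>[OF i] by blast
  qed
  also have "\<dots> = 4 * (real d * H)" unfolding H_def by (simp add: sum_distrib_left mult.assoc)
  also have "\<dots> \<le> 4 * Bv" unfolding Bv_def by simp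
  finally have cardS: "real (card S) \<le> 4 * Bv" .
  have dB: "real d \<le> Bv"
  proof -
    have "real d * 1 \<le> real d * real n" using n by (intro mult_left_mono) auto
    thus ?thesis unfolding Bv_def using H0 by (simp add: add_increasing)
  qed
  \<comment> \<open>\<open>n \<ge> 1\<close> and \<open>totient m \<ge> 2\<close> keep the base
    \<open>Bv\<close> at least \<open>2\<close>, so that rounding it up to \<open>N\<close> costs no
    more than squaring it.\<close>
  hence B2: "Bv \<ge> 2" using d2 by linarith
  define N where "N = nat \<lceil>Bv\<rceil>"
  have NB: "Bv \<le> real N" unfolding N_def using B2 by linarith
  have "real N \<le> Bv + 1" unfolding N_def using B2 by linarith
  also have "\<dots> \<le> 2 * Bv" using B2 by simp
  also have "\<dots> \<le> Bv * Bv" using B2 by (intro mult_right_mono) auto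
  finally have NB2: "real N \<le> Bv ^ 2" by (simp add: power2_eq_square)
  have N2: "N \<ge> 2" using B2 NB by linarith
  have dN: "d \<le> N" using dB NB by linarith
  have "m \<le> 2 * d ^ 2" unfolding d_def by (rule le_twice_totient_squared[OF m0])
  also have "\<dots> \<le> 2 * N ^ 2" using dN by (intro mult_left_mono power_mono) auto
  finally have mN: "m \<le> 2 * N ^ 2" .
  have "real (card S) \<le> real (4 * N)" using cardS NB by simp
  hence SN: "card S \<le> 4 * N" by (simp only: of_nat_le_iff)
  note num = twentieth_power_suffices[OF N2 mN SN order_trans[OF Dd dN]]
  have m3: "m \<ge> 3" using m by simp
  obtain p a where p: "Factorial_Ring.prime p" "p \<notin> S" "\<not> p dvd m"
    and dvd: "int p dvd poly (min_int_poly \<zeta>) (int (m * a))" and ple: "p \<le> (m * N ^ 20 + 1) ^ D"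
    using exists_prime_dvd_min_int_poly[OF m0 prim m3 finS order_refl num(2)[unfolded D_def]]
    unfolding D_def by metis
  \<comment> \<open>The constant \<open>48\<close> is \<open>2 * 24\<close>: it combines
    \<open>m * N ^ 20 + 1 \<le> N ^ 24\<close> with \<open>N \<le> Bv ^ 2\<close>.\<close>
  have "real p \<le> real ((m * N ^ 20 + 1) ^ D)" using ple by (simp only: of_nat_le_iff)
  also have "\<dots> \<le> real ((N ^ 24) ^ D)" using num(1) by (intro of_nat_mono power_mono) auto
  also have "\<dots> = (real N ^ 24) ^ D" by simp
  also have "\<dots> \<le> (real N ^ 24) ^ d" using N2 Dd by (intro power_increasing) auto
  also have "\<dots> \<le> ((Bv ^ 2) ^ 24) ^ d" using NB2 by (intro power_mono) auto
  also have "\<dots> = Bv ^ (48 * d)" by (simp flip: power_mult)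
  also have "\<dots> = Bv powr real (48 * d)" using B2 by (intro powr_realpow[symmetric]) simp
  also have "\<dots> \<le> Bv powr (48 * real d * real (delta m))"
  proof (rule powr_mono)
    have "48 * real d * 1 \<le> 48 * real d * real (delta m)"
      using delta_ge_1[OF m0] by (intro mult_left_mono) auto
    thus "real (48 * d) \<le> 48 * real d * real (delta m)" by simp
  qed (use B2 in simp)
  finally have bound: "real p \<le> Bv powr (48 * real d * real (delta m))" .
  let ?\<sigma> = "padic_embedding \<zeta> p (m * a)"
  have "padic_abs p (?\<sigma> (\<beta> i)) = 1" if i: "i \<in> {1..n}" for i
  proof -
    obtain b where b: "b \<noteq> 0" "poly (of_int_poly b) (\<beta> i) = 0" using alg[OF i] by blast
    have "p \<notin> bad_primes (\<beta> i)" using p(2) i unfolding S_def by blast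
    from not_in_bad_primes[OF b _ deg[OF i] p(1) this] \<beta>[OF i] show ?thesis
      by (intro padic_abs_padic_embedding_eq_1[OF m0 prim p(1,3) dvd]) auto
  qed
  moreover have "?\<sigma> \<in> Ring.ring_hom (rat_adjoin \<zeta>) (padic_field p)"
    by (rule padic_embedding_ring_hom[OF m0 prim p(1,3) dvd])
  moreover have "inj_on ?\<sigma> (carrier (rat_adjoin \<zeta>))"
    by (rule inj_on_padic_embedding[OF m0 prim p(1,3) dvd])
  ultimately show ?thesis using p(1) bound unfolding Bv_def H_def d_def B_def by blast
qed

theorem theorem1p6:
  shows "\<exists>c::real. c > 0 \<and>
    (\<forall>(m::nat) (\<zeta>::complex) (n::nat) (\<beta>::nat \<Rightarrow> complex).
      m > 2 \<longrightarrow> primitive_root_of_unity m \<zeta> \<longrightarrow> n \<ge> 1 \<longrightarrow>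
      (\<forall>i\<in>{1..n}. \<beta> i \<in> carrier (rat_adjoin \<zeta>) \<and> \<beta> i \<noteq> 0) \<longrightarrow>
      (let d = real (totient m) in
        \<exists>p::nat. Factorial_Ring.prime p \<and>
          real p \<le> (d * (\<Sum>i=1..n. weil_height (\<beta> i)) + d * real n) powr (c * d * real (delta m)) \<and>
          (\<exists>\<sigma>. \<sigma> \<in> Ring.ring_hom (rat_adjoin \<zeta>) (padic_field p) \<and>
               inj_on \<sigma> (carrier (rat_adjoin \<zeta>)) \<and>
               (\<forall>i\<in>{1..n}. padic_abs p (\<sigma> (\<beta> i)) = 1))))"
proof (rule exI[of _ 48], intro conjI allI impI)
  fix m n :: nat and \<zeta> :: complex and \<beta> :: "nat \<Rightarrow> complex"
  assume "m > 2" "primitive_root_of_unity m \<zeta>" "n \<ge> 1"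
    "\<forall>i\<in>{1..n}. \<beta> i \<in> carrier (rat_adjoin \<zeta>) \<and> \<beta> i \<noteq> 0"
  thus "let d = real (totient m) in
        \<exists>p::nat. Factorial_Ring.prime p \<and>
          real p \<le> (d * (\<Sum>i=1..n. weil_height (\<beta> i)) + d * real n) powr (48 * d * real (delta m)) \<and>
          (\<exists>\<sigma>. \<sigma> \<in> Ring.ring_hom (rat_adjoin \<zeta>) (padic_field p) \<and>
               inj_on \<sigma> (carrier (rat_adjoin \<zeta>)) \<and>
               (\<forall>i\<in>{1..n}. padic_abs p (\<sigma> (\<beta> i)) = 1))"
    unfolding Let_def by (intro exists_padic_embedding) auto
qed simp

end
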